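(* Let $J$ be an almost complex structure on a $4$-dimensional unimodular real Lie algebra $\mathfrak{g}$. Then $h_J^-=b^+(\mathfrak{g})$ or $h_J^-=b^+(\mathfrak{g})-1$. Moreover, $J$ is tamed if and only if $$h_J^-=b^+(\mathfrak{g})-1.$$
   Context: $\mathfrak{g}$ is unimodular if $\mathrm{tr}(\mathrm{ad}_\xi)=0$ for all $\xi\in\mathfrak{g}$ (equivalently, its top-degree Chevalley–Eilenberg cohomology is $1$-dimensional). $H^*(\mathfrak{g})$ is the Chevalley–Eilenberg cohomology (real coefficients) of $(\Lambda^*(\mathfrak{g}^* ),d)$, $d\phi(u,v)=-\phi([u,v])$ on $1$-forms. An almost complex structure is a linear automorphism $J$ of the vector space $\mathfrak{g}$ with $J^2=-\mathrm{id}$; $\mathfrak{g}$ carries the orientation induced by $J$. Fix a nonzero $\zeta\in\Lambda^4(\mathfrak{g})$ inducing the orientation; for $\mathfrak{g}$ unimodular, $(\alpha,\beta)\mapsto(\alpha\wedge\beta)(\zeta)$ on closed $2$-forms induces a symmetric non-degenerate pairing on $H^2(\mathfrak{g})$ of signature $(b^+(\mathfrak{g}),b^+(\mathfrak{g}))$, where $b^+(\mathfrak{g})$ is the maximal dimension of a (positive) definite subspace of $H^2(\mathfrak{g})$. $\Lambda_J^{\pm}(\mathfrak{g}^* )$ are the $\pm1$-eigenspaces of $\alpha(\cdot,\cdot)\mapsto\alpha(J\cdot,J\cdot)$ on $\Lambda^2(\mathfrak{g}^* )$. $H_J^{\pm}(\mathfrak{g})\subset H^2(\mathfrak{g})$ is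 the subspace of classes that can be represented by a closed form in $\Lambda_J^\pm(\mathfrak{g}^* )$, and $h_J^-=\dim H_J^-(\mathfrak{g})$. $J$ is tamed if there exists a closed $2$-form $\varphi$ on $\mathfrak{g}$ with $\varphi(v,Jv)>0$ for all nonzero $v\in\mathfrak{g}$. *)

theory Defs
  imports "HOL-Analysis.Analysis"
begin

section \<open>Real Lie algebras\<close>

text \<open>No finiteness is built into the class: the dimension of the Lie algebra is that of its
  underlying real vector space, \<^term>\<open>dim (UNIV :: 'a::real_vector set)\<close>.\<close>

class real_lie_algebra = real_vector +
  fixes bracket :: "'a \<Rightarrow> 'a \<Rightarrow> 'a"
  assumes bracket_add_left: "bracket (x + y) z = bracket x z + bracket y z"
    and bracket_add_right: "bracket x (y + z) = bracket x y + bracket x z"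
    and bracket_scaleR_left: "bracket (c *\<^sub>R x) y = c *\<^sub>R bracket x y"
    and bracket_scaleR_right: "bracket x (c *\<^sub>R y) = c *\<^sub>R bracket x y"
    and bracket_self: "bracket x x = 0"
    and jacobi: "bracket x (bracket y z) + bracket y (bracket z x) + bracket z (bracket x y) = 0"

definition ad :: "'a::real_lie_algebra \<Rightarrow> 'a \<Rightarrow> 'a" where
  "ad \<xi> = (\<lambda>x. bracket \<xi> x)"

text \<open>Trace of an endomorphism of a finite-dimensional space: the sum of the diagonal
  coefficients in a basis. The choice of basis is immaterial by \<open>endo_trace_eq\<close>.\<close>

definition endo_trace :: "('a::real_vector \<Rightarrow> 'a) \<Rightarrow> real" where
  "endo_trace f =
    (let B = (SOME B. independent B \<and> span B = UNIV) in \<Sum>b\<in>B. representation B (f b) b)"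

lemma endo_trace_basis_change:
  fixes f :: "'a::real_vector \<Rightarrow> 'a"
  assumes f: "linear f" and B: "independent B" "span B = UNIV" "finite B"
    and C: "independent C" "span C = UNIV" "finite C"
  shows "(\<Sum>b\<in>B. representation B (f b) b) = (\<Sum>c\<in>C. representation C (f c) c)"
proof -
  interpret f: linear f by (rule f)
  have expC: "(\<Sum>c\<in>C. representation C x c *\<^sub>R c) = x" for x
    using real_vector.sum_representation_eq[OF C(1) _ C(3) order_refl, of x] C(2) by simp
  have expB: "(\<Sum>b\<in>B. representation B x b *\<^sub>R b) = x" for x
    using real_vector.sum_representation_eq[OF B(1) _ B(3) order_refl, of x] B(2) by simp
  have repB: "representation B (\<Sum>c\<in>A. g c *\<^sub>R h c) b = (\<Sum>c\<in>A. g c * representation B (h c) b)"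
    for g :: "'a \<Rightarrow> real" and h A b
    using B by (simp add: real_vector.representation_sum real_vector.representation_scale)
  have repC: "representation C (\<Sum>c\<in>A. g c *\<^sub>R h c) b = (\<Sum>c\<in>A. g c * representation C (h c) b)"
    for g :: "'a \<Rightarrow> real" and h A b
    using C by (simp add: real_vector.representation_sum real_vector.representation_scale)
  have "(\<Sum>b\<in>B. representation B (f b) b)
      = (\<Sum>b\<in>B. representation B (f (\<Sum>c\<in>C. representation C b c *\<^sub>R c)) b)"
    by (simp only: expC)
  also have "\<dots> = (\<Sum>b\<in>B. \<Sum>c\<in>C. representation C b c * representation B (f c) b)"
    by (simp add: f.sum f.scale repB)
  also have "\<dots> = (\<Sum>c\<in>C. \<Sum>b\<in>B. representation B (f c) b * representation C b c)"
    by (subst sum.swap) (simp add: mult.commute)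
  also have "\<dots> = (\<Sum>c\<in>C. representation C (\<Sum>b\<in>B. representation B (f c) b *\<^sub>R b) c)"
    by (simp only: repC)
  also have "\<dots> = (\<Sum>c\<in>C. representation C (f c) c)"
    by (simp only: expB)
  finally show ?thesis .
qed

lemma endo_trace_eq:
  fixes f :: "'a::real_vector \<Rightarrow> 'a"
  assumes f: "linear f" and B: "independent B" "span B = UNIV" "finite B"
  shows "endo_trace f = (\<Sum>b\<in>B. representation B (f b) b)"
proof -
  let ?P = "\<lambda>C :: 'a set. independent C \<and> span C = UNIV"
  define C where "C = (SOME C. ?P C)"
  have "?P B" using B by blast
  then have C: "?P C" unfolding C_def by (rule someI[of ?P])
  have "C \<subseteq> span B" using B(2) by blast
  then have "finite C"
    using real_vector.independent_span_bound[OF B(3), of C] C by blast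
  then have "(\<Sum>b\<in>B. representation B (f b) b) = (\<Sum>c\<in>C. representation C (f c) c)"
    using endo_trace_basis_change[OF f B, of C] C by blast
  then show ?thesis by (simp only: endo_trace_def Let_def C_def)
qed

definition unimodular :: "'a::real_lie_algebra itself \<Rightarrow> bool" where
  "unimodular _ \<longleftrightarrow> (\<forall>\<xi>::'a. endo_trace (ad \<xi>) = 0)"


section \<open>Alternating forms of degree two and four\<close>

typedef (overloaded) 'a two_form =
  "{\<alpha> :: 'a::real_vector \<Rightarrow> 'a \<Rightarrow> real. bilinear \<alpha> \<and> (\<forall>v. \<alpha> v v = 0)}"
  morphisms form2 Abs_two_form
  by (rule exI[of _ "\<lambda>_ _. 0"]) (simp add: bilinear_def linear_iff)

setup_lifting type_definition_two_form

instantiation two_form :: (real_vector) real_vector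
begin

lift_definition zero_two_form :: "'a two_form" is "\<lambda>_ _. 0"
  by (simp add: bilinear_def linear_iff)
lift_definition plus_two_form :: "'a two_form \<Rightarrow> 'a two_form \<Rightarrow> 'a two_form"
  is "\<lambda>\<alpha> \<beta> u v. \<alpha> u v + \<beta> u v"
  by (auto simp: bilinear_def linear_iff algebra_simps)
lift_definition minus_two_form :: "'a two_form \<Rightarrow> 'a two_form \<Rightarrow> 'a two_form"
  is "\<lambda>\<alpha> \<beta> u v. \<alpha> u v - \<beta> u v"
  by (auto simp: bilinear_def linear_iff algebra_simps)
lift_definition uminus_two_form :: "'a two_form \<Rightarrow> 'a two_form"
  is "\<lambda>\<alpha> u v. - \<alpha> u v"
  by (auto simp: bilinear_def linear_iff algebra_simps)
lift_definition scaleR_two_form :: "real \<Rightarrow> 'a two_form \<Rightarrow> 'a two_form"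
  is "\<lambda>c \<alpha> u v. c * \<alpha> u v"
  by (auto simp: bilinear_def linear_iff algebra_simps)

instance
  by standard (transfer; simp add: fun_eq_iff algebra_simps)+

end

lemmas form2_simps =
  zero_two_form.rep_eq plus_two_form.rep_eq minus_two_form.rep_eq uminus_two_form.rep_eq
  scaleR_two_form.rep_eq

definition multilinear4 :: "('a::real_vector \<Rightarrow> 'a \<Rightarrow> 'a \<Rightarrow> 'a \<Rightarrow> real) \<Rightarrow> bool" where
  "multilinear4 \<eta> \<longleftrightarrow>
    (\<forall>b c d. linear (\<lambda>a. \<eta> a b c d)) \<and> (\<forall>a c d. linear (\<lambda>b. \<eta> a b c d)) \<and>
    (\<forall>a b d. linear (\<lambda>c. \<eta> a b c d)) \<and> (\<forall>a b c. linear (\<lambda>d. \<eta> a b c d))"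

definition alternating4 :: "('a \<Rightarrow> 'a \<Rightarrow> 'a \<Rightarrow> 'a \<Rightarrow> real) \<Rightarrow> bool" where
  "alternating4 \<eta> \<longleftrightarrow>
    (\<forall>a b c d. (a = b \<or> a = c \<or> a = d \<or> b = c \<or> b = d \<or> c = d) \<longrightarrow> \<eta> a b c d = 0)"

typedef (overloaded) 'a four_form =
  "{\<eta> :: 'a::real_vector \<Rightarrow> 'a \<Rightarrow> 'a \<Rightarrow> 'a \<Rightarrow> real. multilinear4 \<eta> \<and> alternating4 \<eta>}"
  morphisms form4 Abs_four_form
  by (rule exI[of _ "\<lambda>_ _ _ _. 0"]) (simp add: multilinear4_def alternating4_def linear_iff)

setup_lifting type_definition_four_form

instantiation four_form :: (real_vector) real_vector
begin

lift_definition zero_four_form :: "'a four_form" is "\<lambda>_ _ _ _. 0"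
  by (simp add: multilinear4_def alternating4_def linear_iff)
lift_definition plus_four_form :: "'a four_form \<Rightarrow> 'a four_form \<Rightarrow> 'a four_form"
  is "\<lambda>\<eta> \<theta> a b c d. \<eta> a b c d + \<theta> a b c d"
  by (simp add: multilinear4_def alternating4_def linear_iff algebra_simps)
lift_definition minus_four_form :: "'a four_form \<Rightarrow> 'a four_form \<Rightarrow> 'a four_form"
  is "\<lambda>\<eta> \<theta> a b c d. \<eta> a b c d - \<theta> a b c d"
  by (simp add: multilinear4_def alternating4_def linear_iff algebra_simps)
lift_definition uminus_four_form :: "'a four_form \<Rightarrow> 'a four_form"
  is "\<lambda>\<eta> a b c d. - \<eta> a b c d"
  by (simp add: multilinear4_def alternating4_def linear_iff algebra_simps)
lift_definition scaleR_four_form :: "real \<Rightarrow> 'a four_form \<Rightarrow> 'a four_form"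
  is "\<lambda>r \<eta> a b c d. r * \<eta> a b c d"
  by (simp add: multilinear4_def alternating4_def linear_iff algebra_simps)

instance
  by standard (transfer; simp add: fun_eq_iff algebra_simps)+

end

lemmas form4_simps =
  zero_four_form.rep_eq plus_four_form.rep_eq minus_four_form.rep_eq uminus_four_form.rep_eq
  scaleR_four_form.rep_eq

text \<open>The wedge product of two-forms, as the signed sum over the six (2,2)-shuffles, so that
  \<open>\<phi>\<^sub>1 \<and> \<phi>\<^sub>2 \<and> \<phi>\<^sub>3 \<and> \<phi>\<^sub>4\<close> is the determinant of the matrix \<open>\<phi>\<^sub>i(v\<^sub>j)\<close>.\<close>

lift_definition wedge22 :: "'a::real_vector two_form \<Rightarrow> 'a two_form \<Rightarrow> 'a four_form"
  is "\<lambda>\<alpha> \<beta> a b c d. \<alpha> a b * \<beta> c d - \<alpha> a c * \<beta> b d + \<alpha> a d * \<beta> b c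
                 + \<alpha> b c * \<beta> a d - \<alpha> b d * \<beta> a c + \<alpha> c d * \<beta> a b"
proof -
  fix \<alpha> \<beta> :: "'a \<Rightarrow> 'a \<Rightarrow> real"
  assume A: "bilinear \<alpha> \<and> (\<forall>v. \<alpha> v v = 0)" and B: "bilinear \<beta> \<and> (\<forall>v. \<beta> v v = 0)"
  have skew: "\<gamma> u v = - \<gamma> v u"
    if \<gamma>: "bilinear \<gamma> \<and> (\<forall>v. \<gamma> v v = 0)" for \<gamma> :: "'a \<Rightarrow> 'a \<Rightarrow> real" and u v
  proof -
    have bil: "bilinear \<gamma>" using \<gamma> by blast
    have "\<gamma> (u + v) (u + v) = (\<gamma> u u + \<gamma> u v) + (\<gamma> v u + \<gamma> v v)"
      by (simp only: bilinear_ladd[OF bil] bilinear_radd[OF bil])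
    moreover have "\<gamma> (u + v) (u + v) = 0" "\<gamma> u u = 0" "\<gamma> v v = 0" using \<gamma> by blast+
    ultimately show ?thesis by linarith
  qed
  have "alternating4 (\<lambda>a b c d. \<alpha> a b * \<beta> c d - \<alpha> a c * \<beta> b d + \<alpha> a d * \<beta> b c
                 + \<alpha> b c * \<beta> a d - \<alpha> b d * \<beta> a c + \<alpha> c d * \<beta> a b)"
    unfolding alternating4_def
  proof (intro allI impI)
    fix a b c d :: 'a
    assume eq: "a = b \<or> a = c \<or> a = d \<or> b = c \<or> b = d \<or> c = d"
    have z: "\<alpha> v v = 0" "\<beta> v v = 0" for v using A B by auto
    show "\<alpha> a b * \<beta> c d - \<alpha> a c * \<beta> b d + \<alpha> a d * \<beta> b c
                 + \<alpha> b c * \<beta> a d - \<alpha> b d * \<beta> a c + \<alpha> c d * \<beta> a b = 0"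
      using eq
    proof (elim disjE)
      assume "a = c"
      then show ?thesis by (simp add: z skew[OF A, of b c] skew[OF B, of b c])
    next
      assume "a = d"
      then show ?thesis
        by (simp add: z skew[OF A, of b d] skew[OF B, of b d] skew[OF A, of c d]
            skew[OF B, of c d])
    next
      assume "b = d"
      then show ?thesis by (simp add: z skew[OF A, of c d] skew[OF B, of c d])
    qed (simp_all add: z)
  qed
  moreover have "multilinear4 (\<lambda>a b c d. \<alpha> a b * \<beta> c d - \<alpha> a c * \<beta> b d + \<alpha> a d * \<beta> b c
                 + \<alpha> b c * \<beta> a d - \<alpha> b d * \<beta> a c + \<alpha> c d * \<beta> a b)"
  proof -
    have lin: "linear (\<lambda>a. \<alpha> a b)" "linear (\<lambda>a. \<alpha> b a)" "linear (\<lambda>a. \<beta> a b)" "linear (\<lambda>a. \<beta> b a)" for b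
      using A B by (auto simp: bilinear_def)
    have mul: "linear (\<lambda>x. f x * r)" "linear (\<lambda>x. r * f x)"
      if "linear f" for f :: "'a \<Rightarrow> real" and r
      using that by (auto simp: linear_iff algebra_simps)
    show ?thesis
      unfolding multilinear4_def
      by (intro conjI allI linear_compose_add linear_compose_sub; (rule mul lin)+)
  qed
  ultimately show "multilinear4 (\<lambda>a b c d. \<alpha> a b * \<beta> c d - \<alpha> a c * \<beta> b d + \<alpha> a d * \<beta> b c
                 + \<alpha> b c * \<beta> a d - \<alpha> b d * \<beta> a c + \<alpha> c d * \<beta> a b) \<and>
      alternating4 (\<lambda>a b c d. \<alpha> a b * \<beta> c d - \<alpha> a c * \<beta> b d + \<alpha> a d * \<beta> b c
                 + \<alpha> b c * \<beta> a d - \<alpha> b d * \<beta> a c + \<alpha> c d * \<beta> a b)"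
    by blast
qed


section \<open>The second Chevalley-Eilenberg cohomology\<close>

definition ce_d1 :: "('a::real_lie_algebra \<Rightarrow> real) \<Rightarrow> 'a \<Rightarrow> 'a \<Rightarrow> real" where
  "ce_d1 \<phi> u v = - \<phi> (bracket u v)"

text \<open>The extension of the differential to two-forms as an antiderivation,
  \<open>d(\<phi> \<and> \<psi>) = d\<phi> \<and> \<psi> - \<phi> \<and> d\<psi>\<close>, written out on three vectors.\<close>

definition ce_d2 :: "'a::real_lie_algebra two_form \<Rightarrow> 'a \<Rightarrow> 'a \<Rightarrow> 'a \<Rightarrow> real" where
  "ce_d2 \<alpha> u v w =
    - form2 \<alpha> (bracket u v) w + form2 \<alpha> (bracket u w) v - form2 \<alpha> (bracket v w) u"

definition closed2 :: "'a::real_lie_algebra two_form \<Rightarrow> bool" where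
  "closed2 \<alpha> \<longleftrightarrow> (\<forall>u v w. ce_d2 \<alpha> u v w = 0)"

definition exact2 :: "'a::real_lie_algebra two_form \<Rightarrow> bool" where
  "exact2 \<alpha> \<longleftrightarrow> (\<exists>\<phi>. linear \<phi> \<and> form2 \<alpha> = ce_d1 \<phi>)"

definition cohomologous :: "'a::real_lie_algebra two_form \<Rightarrow> 'a two_form \<Rightarrow> bool" where
  "cohomologous \<alpha> \<beta> \<longleftrightarrow> closed2 \<alpha> \<and> closed2 \<beta> \<and> exact2 (\<alpha> - \<beta>)"

lemma exact2_imp_closed2:
  fixes \<alpha> :: "'a::real_lie_algebra two_form"
  assumes "exact2 \<alpha>"
  shows "closed2 \<alpha>"
proof -
  obtain \<phi> where \<phi>: "linear \<phi>" "form2 \<alpha> = ce_d1 \<phi>"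
    using assms unfolding exact2_def by blast
  have skew: "bracket y x = - bracket x y" for x y :: 'a
  proof -
    have "bracket (x + y) (x + y) = bracket x x + bracket x y + (bracket y x + bracket y y)"
      by (simp only: bracket_add_left bracket_add_right add.assoc)
        (simp add: add_ac)
    then have "bracket x y + bracket y x = 0"
      by (simp add: bracket_self)
    then show ?thesis by (simp add: add_eq_0_iff)
  qed
  have neg: "bracket x (- y) = - bracket x y" for x y :: 'a
    using bracket_scaleR_right[of x "-1" y] by simp
  show ?thesis
    unfolding closed2_def
  proof (intro allI)
    fix u v w :: 'a
    have eqs: "bracket (bracket u v) w = - bracket w (bracket u v)"
      "bracket (bracket u w) v = bracket v (bracket w u)"
      "bracket (bracket v w) u = - bracket u (bracket v w)"
      using skew[of w "bracket u v"] skew[of v "bracket u w"] skew[of u "bracket v w"]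
        skew[of w u] by (simp_all add: neg)
    have "ce_d2 \<alpha> u v w = \<phi> (bracket (bracket u v) w) - \<phi> (bracket (bracket u w) v)
        + \<phi> (bracket (bracket v w) u)"
      by (simp add: ce_d2_def \<phi>(2) ce_d1_def)
    also have "\<dots> = - \<phi> (bracket u (bracket v w) + bracket v (bracket w u)
        + bracket w (bracket u v))"
      unfolding eqs by (simp add: linear_add[OF \<phi>(1)] linear_neg[OF \<phi>(1)])
    also have "\<dots> = 0"
      by (simp add: jacobi linear_0[OF \<phi>(1)])
    finally show "ce_d2 \<alpha> u v w = 0" .
  qed
qed

lemma closed2_0: "closed2 0"
  by (simp add: closed2_def ce_d2_def form2_simps)

lemma closed2_add: "closed2 \<alpha> \<Longrightarrow> closed2 \<beta> \<Longrightarrow> closed2 (\<alpha> + \<beta>)"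
proof -
  have "ce_d2 (\<alpha> + \<beta>) u v w = ce_d2 \<alpha> u v w + ce_d2 \<beta> u v w" for u v w
    by (simp add: ce_d2_def form2_simps)
  then show "closed2 \<alpha> \<Longrightarrow> closed2 \<beta> \<Longrightarrow> closed2 (\<alpha> + \<beta>)"
    by (simp add: closed2_def)
qed

lemma closed2_scaleR: "closed2 \<alpha> \<Longrightarrow> closed2 (c *\<^sub>R \<alpha>)"
proof -
  have "ce_d2 (c *\<^sub>R \<alpha>) u v w = c * ce_d2 \<alpha> u v w" for u v w
    by (simp add: ce_d2_def form2_simps algebra_simps)
  then show "closed2 \<alpha> \<Longrightarrow> closed2 (c *\<^sub>R \<alpha>)"
    by (simp add: closed2_def)
qed

lemma closed2_minus: "closed2 \<alpha> \<Longrightarrow> closed2 (- \<alpha>)"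
  using closed2_scaleR[of \<alpha> "-1"] by simp

lemma exact2_0: "exact2 0"
  unfolding exact2_def
  by (rule exI[of _ "\<lambda>_. 0"]) (simp add: linear_iff form2_simps ce_d1_def fun_eq_iff)

lemma exact2_add:
  assumes "exact2 \<alpha>" "exact2 \<beta>"
  shows "exact2 (\<alpha> + \<beta>)"
proof -
  obtain \<phi> \<psi> where "linear \<phi>" "form2 \<alpha> = ce_d1 \<phi>" "linear \<psi>" "form2 \<beta> = ce_d1 \<psi>"
    using assms unfolding exact2_def by blast
  then show ?thesis
    unfolding exact2_def
    by (intro exI[of _ "\<lambda>x. \<phi> x + \<psi> x"])
      (auto simp: form2_simps ce_d1_def fun_eq_iff intro: linear_compose_add)
qed

lemma exact2_scaleR:
  assumes "exact2 \<alpha>"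
  shows "exact2 (c *\<^sub>R \<alpha>)"
proof -
  obtain \<phi> where "linear \<phi>" "form2 \<alpha> = ce_d1 \<phi>"
    using assms unfolding exact2_def by blast
  then show ?thesis
    unfolding exact2_def
    by (intro exI[of _ "\<lambda>x. c * \<phi> x"])
      (auto simp: form2_simps ce_d1_def fun_eq_iff linear_iff algebra_simps)
qed

lemma exact2_minus: "exact2 \<alpha> \<Longrightarrow> exact2 (- \<alpha>)"
  using exact2_scaleR[of \<alpha> "-1"] by simp

lemma part_equivp_cohomologous:
  "part_equivp (cohomologous :: 'a::real_lie_algebra two_form \<Rightarrow> _)"
proof (rule part_equivpI)
  show "\<exists>\<alpha> :: 'a two_form. cohomologous \<alpha> \<alpha>"
    by (rule exI[of _ 0]) (simp add: cohomologous_def closed2_0 exact2_0)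
  show "symp (cohomologous :: 'a two_form \<Rightarrow> _)"
  proof (rule sympI)
    fix \<alpha> \<beta> :: "'a two_form"
    assume "cohomologous \<alpha> \<beta>"
    then show "cohomologous \<beta> \<alpha>"
      using exact2_minus[of "\<alpha> - \<beta>"] by (simp add: cohomologous_def)
  qed
  show "transp (cohomologous :: 'a two_form \<Rightarrow> _)"
  proof (rule transpI)
    fix \<alpha> \<beta> \<gamma> :: "'a two_form"
    assume "cohomologous \<alpha> \<beta>" "cohomologous \<beta> \<gamma>"
    then show "cohomologous \<alpha> \<gamma>"
      using exact2_add[of "\<alpha> - \<beta>" "\<beta> - \<gamma>"] by (simp add: cohomologous_def)
  qed
qed

lemma cohomologous_refl: "closed2 \<alpha> \<Longrightarrow> cohomologous \<alpha> \<alpha>"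
  by (simp add: cohomologous_def exact2_0)

text \<open>Closed two-forms modulo exact ones. The domain of the partial equivalence relation is the
  set of closed forms, so \<open>coh_class \<alpha>\<close> below is meaningful only for closed \<open>\<alpha>\<close>.\<close>

quotient_type (overloaded) 'a H2 = "'a::real_lie_algebra two_form" / partial: cohomologous
  by (rule part_equivp_cohomologous)

definition coh_class :: "'a::real_lie_algebra two_form \<Rightarrow> 'a H2" where
  "coh_class = abs_H2"

instantiation H2 :: (real_lie_algebra) real_vector
begin

lift_definition zero_H2 :: "'a H2" is "0"
  by (simp add: cohomologous_def closed2_0 exact2_0)

lift_definition plus_H2 :: "'a H2 \<Rightarrow> 'a H2 \<Rightarrow> 'a H2" is "(+)"
proof -
  fix \<alpha> \<alpha>' \<beta> \<beta>' :: "'a two_form"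
  assume "cohomologous \<alpha> \<alpha>'" "cohomologous \<beta> \<beta>'"
  then show "cohomologous (\<alpha> + \<beta>) (\<alpha>' + \<beta>')"
    using exact2_add[of "\<alpha> - \<alpha>'" "\<beta> - \<beta>'"]
    by (simp add: cohomologous_def closed2_add add_diff_add)
qed

lift_definition scaleR_H2 :: "real \<Rightarrow> 'a H2 \<Rightarrow> 'a H2" is "scaleR"
proof -
  fix c :: real and \<alpha> \<alpha>' :: "'a two_form"
  assume "cohomologous \<alpha> \<alpha>'"
  then show "cohomologous (c *\<^sub>R \<alpha>) (c *\<^sub>R \<alpha>')"
    using exact2_scaleR[of "\<alpha> - \<alpha>'" c]
    by (simp add: cohomologous_def closed2_scaleR scaleR_diff_right)
qed

definition uminus_H2 :: "'a H2 \<Rightarrow> 'a H2" where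
  "uminus_H2 x = (-1) *\<^sub>R x"

definition minus_H2 :: "'a H2 \<Rightarrow> 'a H2 \<Rightarrow> 'a H2" where
  "minus_H2 x y = x + (- y)"

instance
proof
  fix x y z :: "'a H2" and a b :: real
  show "x + y + z = x + (y + z)"
    by transfer (simp add: cohomologous_def closed2_add exact2_0 add.assoc)
  show "x + y = y + x"
    by transfer (simp add: cohomologous_def closed2_add exact2_0 add.commute)
  show "0 + x = x"
    by transfer (simp add: cohomologous_def)
  show "- x + x = 0"
    unfolding uminus_H2_def by transfer (simp add: cohomologous_def closed2_0 exact2_0)
  show "x - y = x + - y"
    by (rule minus_H2_def)
  show "a *\<^sub>R (x + y) = a *\<^sub>R x + a *\<^sub>R y"
    by transfer
      (simp add: cohomologous_def closed2_add closed2_scaleR exact2_0 scaleR_add_right)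
  show "(a + b) *\<^sub>R x = a *\<^sub>R x + b *\<^sub>R x"
    by transfer
      (simp add: cohomologous_def closed2_add closed2_scaleR exact2_0 scaleR_add_left)
  show "a *\<^sub>R b *\<^sub>R x = (a * b) *\<^sub>R x"
    by transfer (simp add: cohomologous_def closed2_scaleR exact2_0)
  show "1 *\<^sub>R x = x"
    by transfer (simp add: cohomologous_def)
qed

end

lemma coh_class_eq_iff:
  "closed2 \<alpha> \<Longrightarrow> closed2 \<beta> \<Longrightarrow> coh_class \<alpha> = coh_class \<beta> \<longleftrightarrow> exact2 (\<alpha> - \<beta>)"
  unfolding coh_class_def
  using Quotient_rel[OF Quotient_H2, of \<alpha> \<beta>]
  by (auto simp: cohomologous_def exact2_0)


section \<open>The pairing and \<open>b\<^sup>+\<close>\<close>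

text \<open>A four-vector, i.e. an element of the fourth exterior power of the (finite-dimensional)
  space, is encoded as a linear functional on four-forms; the decomposable ones are the following.\<close>

definition wedge_vec4 :: "'a::real_vector \<Rightarrow> 'a \<Rightarrow> 'a \<Rightarrow> 'a \<Rightarrow> 'a four_form \<Rightarrow> real" where
  "wedge_vec4 a b c d = (\<lambda>\<eta>. form4 \<eta> a b c d)"

text \<open>The orientation induced by \<open>J\<close> is the one in which the bases \<open>(v, J v, w, J w)\<close> are
  positive. In dimension four these bases all lie in one orientation class, so one of them
  suffices to test a four-vector.\<close>

definition induces_orientation ::
    "('a::real_vector \<Rightarrow> 'a) \<Rightarrow> ('a four_form \<Rightarrow> real) \<Rightarrow> bool" where
  "induces_orientation J \<zeta> \<longleftrightarrow>
    (\<exists>v w c. independent {v, J v, w, J w} \<and> card {v, J v, w, J w} = 4 \<and> 0 < c \<and>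
      \<zeta> = (\<lambda>\<eta>. c * wedge_vec4 v (J v) w (J w) \<eta>))"

text \<open>The pairing on cohomology evaluates \<open>\<alpha> \<and> \<beta>\<close> on \<open>\<zeta>\<close> for representatives chosen by
  \<^const>\<open>rep_H2\<close>; on a four-dimensional unimodular Lie algebra the value does not depend on them.\<close>

definition pairing :: "('a::real_lie_algebra four_form \<Rightarrow> real) \<Rightarrow> 'a H2 \<Rightarrow> 'a H2 \<Rightarrow> real" where
  "pairing \<zeta> x y = \<zeta> (wedge22 (rep_H2 x) (rep_H2 y))"

definition positive_definite_on ::
    "('a::real_lie_algebra four_form \<Rightarrow> real) \<Rightarrow> 'a H2 set \<Rightarrow> bool" where
  "positive_definite_on \<zeta> W \<longleftrightarrow> (\<forall>x\<in>W. x \<noteq> 0 \<longrightarrow> 0 < pairing \<zeta> x x)"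

definition b_plus :: "('a::real_lie_algebra four_form \<Rightarrow> real) \<Rightarrow> nat" where
  "b_plus \<zeta> = Max (dim ` {W :: 'a H2 set. subspace W \<and> positive_definite_on \<zeta> W})"


section \<open>Almost complex structures\<close>

definition almost_complex :: "('a::real_vector \<Rightarrow> 'a) \<Rightarrow> bool" where
  "almost_complex J \<longleftrightarrow> linear J \<and> (\<forall>v. J (J v) = - v)"

definition Lambda_J_minus :: "('a::real_vector \<Rightarrow> 'a) \<Rightarrow> 'a two_form set" where
  "Lambda_J_minus J = {\<alpha>. \<forall>u v. form2 \<alpha> (J u) (J v) = - form2 \<alpha> u v}"

definition H_J_minus :: "('a::real_lie_algebra \<Rightarrow> 'a) \<Rightarrow> 'a H2 set" where
  "H_J_minus J = coh_class ` {\<alpha> \<in> Lambda_J_minus J. closed2 \<alpha>}"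

definition h_J_minus :: "('a::real_lie_algebra \<Rightarrow> 'a) \<Rightarrow> nat" where
  "h_J_minus J = dim (H_J_minus J)"

definition tamed :: "('a::real_lie_algebra \<Rightarrow> 'a) \<Rightarrow> bool" where
  "tamed J \<longleftrightarrow> (\<exists>\<phi>. closed2 \<phi> \<and> (\<forall>v. v \<noteq> 0 \<longrightarrow> 0 < form2 \<phi> v (J v)))"

end

theory Submission
  imports Defs
begin

text \<open>The wedge product makes the two-forms on \<open>\<gg>\<close> a six-dimensional quadratic space \<open>V\<close> of
  signature \<open>(3, 3)\<close>. With respect to it let \<open>Z\<close> be the closed and \<open>B\<close> the exact forms, and put
  \<open>k = dim B\<close>. Unimodularity enters once: it says that the differential of a three-form vanishes, so
  \<open>\<alpha> \<and> d\<phi>\<close> is, up to sign, \<open>d\<alpha> \<and> \<phi>\<close>, and hence \<open>Z\<close> is exactly the orthogonal complement of \<open>B\<close>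
  (\<open>closed2_iff_wedge_exact\<close>). In particular \<open>B \<subseteq> Z\<close> is isotropic, \<open>dim Z = 6 - k\<close>, and the pairing on
  \<open>Z / B\<close> is well defined. A positive definite subspace of \<open>Z / B\<close> lifts to \<open>Z\<close>; its sum with \<open>B\<close> is
  positive semidefinite and misses the three-dimensional negative definite space of anti-self-dual
  forms, which gives \<open>b\<^sup>+ \<le> 3 - k\<close> (\<open>b_plus_add_dim_exact_le\<close>).

  The \<open>J\<close>-anti-invariant forms make up a positive definite plane \<open>L\<close>. So \<open>L \<inter> Z\<close> injects into
  cohomology, \<open>h\<^sub>J\<^sup>- = dim (L \<inter> Z) = 2 + (6 - k) - dim (L + Z)\<close>, and \<open>h\<^sub>J\<^sup>- \<le> b\<^sup>+\<close>. Because
  \<open>dim (L + Z) \<le> 6\<close>, also \<open>h\<^sub>J\<^sup>- \<ge> 2 - k \<ge> b\<^sup>+ - 1\<close>.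

  Taming decides between the two values. Whether a form tames \<open>J\<close> depends only on its \<open>J\<close>-invariant
  part, that is, on its class modulo \<open>L\<close>. If \<open>J\<close> is not tamed, then the fundamental form of a
  compatible metric is not in \<open>L + Z\<close>; so \<open>dim (L + Z) \<le> 5\<close> and \<open>h\<^sub>J\<^sup>- \<ge> 3 - k \<ge> b\<^sup>+\<close>. If a closed
  \<open>\<phi>\<close> tames \<open>J\<close>, then its invariant part is positive as a Hermitian form, hence has positive square,
  and \<open>L \<inter> Z\<close> together with \<open>\<phi>\<close> spans a positive definite subspace of dimension \<open>h\<^sub>J\<^sup>- + 1\<close>, whence
  \<open>b\<^sup>+ \<ge> h\<^sub>J\<^sup>- + 1\<close>.

  All of this takes place in coordinates: a frame \<open>(v, J v, w, J w)\<close> identifies \<open>V\<close> with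
  \<open>\<real>\<^sup>3 \<times> \<real>\<^sup>3\<close>, self-dual times anti-self-dual forms, where the wedge product becomes twice the
  difference of the two Euclidean inner products, \<open>L\<close> a coordinate plane of the self-dual factor, and
  the fundamental form the unit vector on the remaining axis of that factor.\<close>

section \<open>Linear maps on subspaces\<close>

lemma linear_inj_on_subspace:
  assumes f: "linear f" and S: "subspace S" and ker: "\<And>x. x \<in> S \<Longrightarrow> f x = 0 \<Longrightarrow> x = 0"
  shows "inj_on f S"
proof (rule inj_onI)
  fix x y assume "x \<in> S" "y \<in> S" "f x = f y"
  then have "f (x - y) = 0" "x - y \<in> S"
    using S by (auto simp: linear_diff[OF f] subspace_diff)
  then show "x = y" using ker by fastforce
qed

lemma dim_linear_image_inj_on:
  fixes f :: "'a::real_vector \<Rightarrow> 'b::real_vector"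
  assumes f: "linear f" and S: "subspace S" and inj: "inj_on f S"
  shows "dim (f ` S) = dim S"
proof -
  obtain A where A: "A \<subseteq> S" "independent A" "S \<subseteq> span A" "card A = dim S"
    using real_vector.basis_exists by blast
  have span: "span A = S"
    using A S by (simp add: real_vector.span_minimal subset_antisym)
  have "independent (f ` A)"
    using f A(2) inj span by (simp add: linear_independent_injective_image)
  moreover have "span (f ` A) = f ` S"
    using f span by (simp add: linear_span_image)
  moreover have "card (f ` A) = card A"
    using inj A(1) by (meson card_image inj_on_subset)
  ultimately show ?thesis
    using A(4) by (metis real_vector.dim_span_eq_card_independent)
qed

text \<open>Cohomology classes are meaningful only for closed forms, so the class map is additive only on a
  subspace; a linear map on the whole space that agrees with it there gives access to the general
  theory of linear maps.\<close>

lemma linear_extension_from_subspace: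
  fixes f :: "'a::real_vector \<Rightarrow> 'b::real_vector"
  assumes S: "subspace S"
    and add: "\<And>x y. x \<in> S \<Longrightarrow> y \<in> S \<Longrightarrow> f (x + y) = f x + f y"
    and scale: "\<And>c x. x \<in> S \<Longrightarrow> f (c *\<^sub>R x) = c *\<^sub>R f x"
  obtains g where "linear g" "\<And>x. x \<in> S \<Longrightarrow> g x = f x"
proof -
  obtain A where A: "A \<subseteq> S" "independent A" "S \<subseteq> span A"
    using real_vector.basis_exists by metis
  obtain g where g: "linear g" "\<And>x. x \<in> A \<Longrightarrow> g x = f x"
    using linear_independent_extend[OF A(2), of f] by blast
  have "x \<in> S \<and> g x = f x" if "x \<in> span A" for x
    using that
  proof (induction rule: span_induct_alt)
    case base
    show ?case
      using scale[OF subspace_0[OF S], of 0] by (simp add: linear_0[OF g(1)] subspace_0[OF S])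
  next
    case (step c x y)
    then show ?case
      using A(1) S g by (auto simp: linear_add linear_scale add scale subspace_add subspace_scale)
  qed
  then show ?thesis
    using that[OF g(1)] A(3) by blast
qed

section \<open>Orthogonality in a quadratic space of split type\<close>

definition split_form :: "'p::euclidean_space \<times> 'n::euclidean_space \<Rightarrow> 'p \<times> 'n \<Rightarrow> real" where
  "split_form x y = fst x \<bullet> fst y - snd x \<bullet> snd y"

definition split_perp :: "('p::euclidean_space \<times> 'n::euclidean_space) set \<Rightarrow> ('p \<times> 'n) set" where
  "split_perp B = {x. \<forall>y\<in>B. split_form x y = 0}"

lemma split_form_add_left: "split_form (x + y) z = split_form x z + split_form y z"
  by (simp add: split_form_def inner_add_left)

lemma split_form_add_right: "split_form x (y + z) = split_form x y + split_form x z"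
  by (simp add: split_form_def inner_add_right)

lemma split_form_commute: "split_form x y = split_form y x"
  by (simp add: split_form_def inner_commute)

lemma subspace_split_perp: "subspace (split_perp B)"
  by (auto simp: split_perp_def subspace_def split_form_def inner_add_left algebra_simps
      simp flip: right_diff_distrib)

text \<open>Reflecting the second factor turns the indefinite form into the Euclidean inner product, for which
  the dimension of a complement is known.\<close>

lemma dim_split_perp:
  fixes B :: "('p::euclidean_space \<times> 'n::euclidean_space) set"
  assumes "subspace B"
  shows "dim (split_perp B) + dim B = DIM('p) + DIM('n)"
proof -
  define r :: "'p \<times> 'n \<Rightarrow> 'p \<times> 'n" where "r = (\<lambda>(x, y). (x, - y))"
  have r: "linear r" "inj r"
    by (auto simp: r_def linear_iff inj_def)
  have "subspace (r ` B)" "dim (r ` B) = dim B"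
    using r assms by (auto intro: linear_subspace_image dim_linear_image_inj_on inj_on_subset)
  moreover have "split_perp B = {x \<in> UNIV. \<forall>y\<in>r ` B. orthogonal y x}"
    by (auto simp: split_perp_def split_form_def r_def orthogonal_def inner_prod_def inner_commute
        split: prod.splits)
  ultimately show ?thesis
    using dim_subspace_orthogonal_to_vectors[of "r ` B" UNIV] by simp
qed

text \<open>The form is positive semidefinite on \<open>W + B\<close>, where its null vectors are those of \<open>B\<close>, while it is
  negative definite on \<open>0 \<times> \<real>\<^sup>n\<close>. The two spaces therefore meet only in \<open>0\<close>.\<close>

lemma dim_positive_plus_isotropic_le:
  fixes B W :: "('p::euclidean_space \<times> 'n::euclidean_space) set"
  assumes B: "subspace B" "B \<subseteq> split_perp B"
    and W: "subspace W" "W \<subseteq> split_perp B"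
    and pos: "\<And>x. x \<in> W \<Longrightarrow> x \<noteq> 0 \<Longrightarrow> 0 < split_form x x"
  shows "dim W + dim B \<le> DIM('p)"
proof -
  define N :: "('p \<times> 'n) set" where "N = range (Pair 0)"
  define S where "S = {w + b |w b. w \<in> W \<and> b \<in> B}"
  have lin: "linear (Pair 0 :: 'n \<Rightarrow> 'p \<times> 'n)"
    by (simp add: linear_iff)
  have N: "subspace N" "dim N = DIM('n)"
    unfolding N_def using lin
    by (auto intro: linear_subspace_image simp: dim_linear_image_inj_on inj_on_def)
  have "W \<inter> B \<subseteq> {0}"
    using pos B(2) by (force simp: split_perp_def)
  then have "dim (W \<inter> B) = 0"
    by simp
  then have "dim S = dim W + dim B"
    using dim_sums_Int[OF W(1) B(1)] unfolding S_def by linarith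
  moreover have "S \<inter> N \<subseteq> {0}"
  proof
    fix x assume "x \<in> S \<inter> N"
    then obtain w b n where x: "x = w + b" "x = (0, n)" "w \<in> W" "b \<in> B"
      by (auto simp: S_def N_def)
    have "split_form x x = split_form w w + 2 * split_form w b + split_form b b"
      by (simp only: x(1) split_form_add_left split_form_add_right split_form_commute[of b w])
    also have "\<dots> = split_form w w"
    proof -
      have "split_form w b = 0" "split_form b b = 0"
        using x(3,4) W(2) B(2) unfolding split_perp_def by blast+
      then show ?thesis by simp
    qed
    finally have "split_form x x = split_form w w" .
    moreover have "split_form w w \<ge> 0"
      using pos[OF x(3)] by (cases "w = 0") (auto simp: split_form_def less_imp_le)
    ultimately have "n \<bullet> n \<le> 0"
      by (simp add: x(2) split_form_def)
    then have "n = 0"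
      by (meson inner_eq_zero_iff inner_ge_zero order_antisym)
    then show "x \<in> {0}"
      by (simp add: x(2) zero_prod_def)
  qed
  moreover have "subspace S"
    unfolding S_def by (rule subspace_sums[OF W(1) B(1)])
  ultimately have "dim {x + y |x y. x \<in> S \<and> y \<in> N} = dim W + dim B + DIM('n)"
    using dim_sums_Int[of S N] N dim_eq_0[of "S \<inter> N"] by linarith
  moreover have "dim {x + y |x y. x \<in> S \<and> y \<in> N} \<le> DIM('p \<times> 'n)"
    by (rule dim_subset_UNIV)
  ultimately show ?thesis by simp
qed

lemma dim_Int_split_perp:
  fixes B L :: "('p::euclidean_space \<times> 'n::euclidean_space) set"
  assumes B: "subspace B" and L: "subspace L"
  shows "DIM('p) + DIM('n) + dim L
    = dim (L \<inter> split_perp B) + dim B + dim {x + y |x y. x \<in> L \<and> y \<in> split_perp B}"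
  using dim_sums_Int[OF L subspace_split_perp[of B]] dim_split_perp[OF B] by linarith

section \<open>Two-forms and their cohomology classes\<close>

lemma form2_add_left: "form2 \<alpha> (u + v) w = form2 \<alpha> u w + form2 \<alpha> v w"
  and form2_add_right: "form2 \<alpha> w (u + v) = form2 \<alpha> w u + form2 \<alpha> w v"
  and form2_scaleR_left: "form2 \<alpha> (c *\<^sub>R u) v = c * form2 \<alpha> u v"
  and form2_scaleR_right: "form2 \<alpha> u (c *\<^sub>R v) = c * form2 \<alpha> u v"
  and form2_self: "form2 \<alpha> u u = 0"
  using form2[of \<alpha>] by (auto simp: bilinear_def linear_iff)

lemma form2_skew: "form2 \<alpha> v u = - form2 \<alpha> u v"
proof -
  have "form2 \<alpha> (u + v) (u + v) = form2 \<alpha> u v + form2 \<alpha> v u"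
    by (simp only: form2_add_left form2_add_right) (simp add: form2_self)
  then show ?thesis
    by (simp add: form2_self)
qed

lemma form2_minus_left: "form2 \<alpha> (- u) v = - form2 \<alpha> u v"
  using form2_scaleR_left[of \<alpha> "-1" u v] by simp

lemma bracket_skew: "bracket v u = - bracket u (v :: 'a::real_lie_algebra)"
proof -
  have "bracket (u + v) (u + v) = bracket u v + bracket v u"
    by (simp only: bracket_add_left bracket_add_right) (simp add: bracket_self)
  then have "bracket u v + bracket v u = 0"
    by (simp only: bracket_self)
  then show ?thesis
    by (metis add.commute add_eq_0_iff)
qed

lemma H2_cases:
  obtains \<alpha> where "closed2 \<alpha>" "x = coh_class \<alpha>"
proof
  show "closed2 (rep_H2 x)"
    using Quotient_rep_reflp[OF Quotient_H2, of x] by (simp add: cohomologous_def)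
  show "x = coh_class (rep_H2 x)"
    by (simp add: coh_class_def Quotient_abs_rep[OF Quotient_H2])
qed

lemma rep_H2_coh_class:
  assumes "closed2 \<alpha>"
  shows "exact2 (rep_H2 (coh_class \<alpha>) - \<alpha>)"
  using Quotient_rep_abs[OF Quotient_H2 cohomologous_refl[OF assms]]
  by (simp add: coh_class_def cohomologous_def)

lemma coh_class_add:
  "closed2 \<alpha> \<Longrightarrow> closed2 \<beta> \<Longrightarrow> coh_class (\<alpha> + \<beta>) = coh_class \<alpha> + coh_class \<beta>"
  unfolding coh_class_def by (simp add: plus_H2.abs_eq cohomologous_refl)

lemma coh_class_scaleR: "closed2 \<alpha> \<Longrightarrow> coh_class (c *\<^sub>R \<alpha>) = c *\<^sub>R coh_class \<alpha>"
  unfolding coh_class_def by (simp add: scaleR_H2.abs_eq cohomologous_refl)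

lemma coh_class_eq_0_iff: "closed2 \<alpha> \<Longrightarrow> coh_class \<alpha> = 0 \<longleftrightarrow> exact2 \<alpha>"
  using coh_class_eq_iff[of \<alpha> 0] by (simp add: closed2_0 zero_H2_def coh_class_def)

section \<open>Frames of a four-dimensional space\<close>

text \<open>Four explicit vectors with their dual coordinates, rather than an indexed basis, so that identities
  between coefficients of forms are polynomial identities in named quantities.\<close>

locale frame4 =
  fixes e1 e2 e3 e4 :: "'a::real_vector" and x1 x2 x3 x4 :: "'a \<Rightarrow> real"
  assumes linear: "linear x1" "linear x2" "linear x3" "linear x4"
    and dual: "x1 e1 = 1" "x1 e2 = 0" "x1 e3 = 0" "x1 e4 = 0"
      "x2 e1 = 0" "x2 e2 = 1" "x2 e3 = 0" "x2 e4 = 0"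
      "x3 e1 = 0" "x3 e2 = 0" "x3 e3 = 1" "x3 e4 = 0"
      "x4 e1 = 0" "x4 e2 = 0" "x4 e3 = 0" "x4 e4 = 1"
    and expand: "v = x1 v *\<^sub>R e1 + x2 v *\<^sub>R e2 + x3 v *\<^sub>R e3 + x4 v *\<^sub>R e4"
begin

lemma rotate: "frame4 e2 e3 e4 e1 x2 x3 x4 x1"
proof (rule frame4.intro)
  show "v = x2 v *\<^sub>R e2 + x3 v *\<^sub>R e3 + x4 v *\<^sub>R e4 + x1 v *\<^sub>R e1" for v
    using expand[of v] by (simp only: add_ac)
qed (simp_all add: linear dual)

lemmas coord_simps =
  linear_add[OF linear(1)] linear_add[OF linear(2)] linear_add[OF linear(3)] linear_add[OF linear(4)]
  linear_scale[OF linear(1)] linear_scale[OF linear(2)] linear_scale[OF linear(3)] linear_scale[OF linear(4)]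
  linear_neg[OF linear(1)] linear_neg[OF linear(2)] linear_neg[OF linear(3)] linear_neg[OF linear(4)]
  linear_0[OF linear(1)] linear_0[OF linear(2)] linear_0[OF linear(3)] linear_0[OF linear(4)]
  dual

lemma eqI: "x1 u = x1 v \<Longrightarrow> x2 u = x2 v \<Longrightarrow> x3 u = x3 v \<Longrightarrow> x4 u = x4 v \<Longrightarrow> u = v"
  by (subst expand[of u], simp only: expand[of v, symmetric])

lemma linear_eq_0I:
  fixes f :: "'a \<Rightarrow> real"
  assumes "linear f" "f e1 = 0" "f e2 = 0" "f e3 = 0" "f e4 = 0"
  shows "f v = 0"
proof -
  have "f (x1 v *\<^sub>R e1 + x2 v *\<^sub>R e2 + x3 v *\<^sub>R e3 + x4 v *\<^sub>R e4) = 0"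
    using assms by (simp add: linear_add linear_scale)
  then show ?thesis
    by (simp only: expand[symmetric])
qed

lemma form2_expand:
  "form2 \<alpha> u v = form2 \<alpha> e1 e2 * (x1 u * x2 v - x2 u * x1 v)
    + form2 \<alpha> e1 e3 * (x1 u * x3 v - x3 u * x1 v) + form2 \<alpha> e1 e4 * (x1 u * x4 v - x4 u * x1 v)
    + form2 \<alpha> e2 e3 * (x2 u * x3 v - x3 u * x2 v) + form2 \<alpha> e2 e4 * (x2 u * x4 v - x4 u * x2 v)
    + form2 \<alpha> e3 e4 * (x3 u * x4 v - x4 u * x3 v)"
proof -
  have "form2 \<alpha> u v = form2 \<alpha> (x1 u *\<^sub>R e1 + x2 u *\<^sub>R e2 + x3 u *\<^sub>R e3 + x4 u *\<^sub>R e4)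
      (x1 v *\<^sub>R e1 + x2 v *\<^sub>R e2 + x3 v *\<^sub>R e3 + x4 v *\<^sub>R e4)"
    by (simp only: expand[symmetric])
  also have "\<dots> = form2 \<alpha> e1 e2 * (x1 u * x2 v - x2 u * x1 v)
    + form2 \<alpha> e1 e3 * (x1 u * x3 v - x3 u * x1 v) + form2 \<alpha> e1 e4 * (x1 u * x4 v - x4 u * x1 v)
    + form2 \<alpha> e2 e3 * (x2 u * x3 v - x3 u * x2 v) + form2 \<alpha> e2 e4 * (x2 u * x4 v - x4 u * x2 v)
    + form2 \<alpha> e3 e4 * (x3 u * x4 v - x4 u * x3 v)"
    unfolding form2_add_left form2_add_right form2_scaleR_left form2_scaleR_right form2_self
      form2_skew[of \<alpha> e2 e1] form2_skew[of \<alpha> e3 e1] form2_skew[of \<alpha> e4 e1]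
      form2_skew[of \<alpha> e3 e2] form2_skew[of \<alpha> e4 e2] form2_skew[of \<alpha> e4 e3]
    by algebra
  finally show ?thesis .
qed

lemma frame_basis:
  "independent {e1, e2, e3, e4}" "span {e1, e2, e3, e4} = UNIV" "distinct [e1, e2, e3, e4]"
proof -
  show dist: "distinct [e1, e2, e3, e4]"
    using dual by auto
  show "independent {e1, e2, e3, e4}"
  proof (rule real_vector.independent_if_scalars_zero)
    fix f and x
    assume "(\<Sum>x\<in>{e1, e2, e3, e4}. f x *\<^sub>R x) = 0" and x: "x \<in> {e1, e2, e3, e4}"
    then have "f e1 *\<^sub>R e1 + (f e2 *\<^sub>R e2 + (f e3 *\<^sub>R e3 + f e4 *\<^sub>R e4)) = 0"
      using dist by simp
    from this[THEN arg_cong[where f = x1]] this[THEN arg_cong[where f = x2]]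
      this[THEN arg_cong[where f = x3]] this[THEN arg_cong[where f = x4]]
    show "f x = 0"
      using x by (auto simp: coord_simps)
  qed simp
  show "span {e1, e2, e3, e4} = UNIV"
  proof -
    have "v \<in> span {e1, e2, e3, e4}" for v
    proof -
      have "x1 v *\<^sub>R e1 + x2 v *\<^sub>R e2 + x3 v *\<^sub>R e3 + x4 v *\<^sub>R e4 \<in> span {e1, e2, e3, e4}"
        by (intro span_add span_scale) (simp_all add: span_base)
      then show ?thesis
        by (simp only: expand[symmetric])
    qed
    then show ?thesis by blast
  qed
qed

lemma endo_trace_frame:
  assumes "linear f"
  shows "endo_trace f = x1 (f e1) + x2 (f e2) + x3 (f e3) + x4 (f e4)"
proof -
  let ?B = "{e1, e2, e3, e4}"
  have rep: "representation ?B v = (\<lambda>b. if b = e1 then x1 v else if b = e2 then x2 v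
      else if b = e3 then x3 v else if b = e4 then x4 v else 0)" for v
  proof (rule real_vector.representation_eqI)
    show "(\<Sum>b | (if b = e1 then x1 v else if b = e2 then x2 v
      else if b = e3 then x3 v else if b = e4 then x4 v else 0) \<noteq> 0. (if b = e1 then x1 v else if b = e2 then x2 v
      else if b = e3 then x3 v else if b = e4 then x4 v else 0) *\<^sub>R b) = v" (is "(\<Sum>b | ?g b \<noteq> 0. _) = v")
    proof -
      have "(\<Sum>b | ?g b \<noteq> 0. ?g b *\<^sub>R b) = (\<Sum>b\<in>?B. ?g b *\<^sub>R b)"
        by (rule sum.mono_neutral_left) (auto split: if_splits)
      also have "\<dots> = v"
        using frame_basis(3) expand[of v, symmetric] by (auto simp: add_ac)
      finally show ?thesis .
    qed
    show "finite {b. ?g b \<noteq> 0}"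
      by (rule finite_subset[of _ ?B]) (auto split: if_splits)
  qed (use frame_basis in \<open>auto split: if_splits\<close>)
  show ?thesis
    using frame_basis(3) by (subst endo_trace_eq[OF assms frame_basis(1,2)]) (auto simp: rep)
qed

end

lemma frame4_of_basis:
  fixes e1 :: "'a::real_vector"
  assumes ind: "independent {e1, e2, e3, e4}" and card: "card {e1, e2, e3, e4} = 4"
    and dim: "dim (UNIV :: 'a set) = 4"
  obtains x1 x2 x3 x4 where "frame4 e1 e2 e3 e4 x1 x2 x3 x4"
proof -
  let ?B = "{e1, e2, e3, e4}"
  obtain C where C: "?B \<subseteq> C" "independent C" "span C = UNIV"
    by (rule real_vector.maximal_independent_subset_extend[OF subset_UNIV ind]) blast
  have "card C = 4"
    using real_vector.dim_span_eq_card_independent[OF C(2)] C(3) dim by simp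
  then have "?B = C"
    by (intro card_subset_eq) (use C(1) card card.infinite[of C] in force)+
  with C have span: "span ?B = UNIV" by simp
  have dist: "distinct [e1, e2, e3, e4]"
    using card by (auto simp: card_insert_if split: if_splits)
  define x where "x b v = representation ?B v b" for b v
  have lin: "linear (x b)" for b
    by (rule linearI) (simp_all add: x_def real_vector.representation_add
        real_vector.representation_scale ind span)
  have dual: "x b b' = (if b = b' then 1 else 0)" if "b' \<in> ?B" for b b'
    using real_vector.representation_basis[OF ind that] by (simp add: x_def)
  have expand: "v = x e1 v *\<^sub>R e1 + x e2 v *\<^sub>R e2 + x e3 v *\<^sub>R e3 + x e4 v *\<^sub>R e4" for v
  proof -
    have "(\<Sum>b\<in>?B. x b v *\<^sub>R b) = v"
      unfolding x_def by (rule real_vector.sum_representation_eq[OF ind]) (simp_all add: span)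
    then show ?thesis
      using dist by (simp add: add.assoc)
  qed
  have "frame4 e1 e2 e3 e4 (x e1) (x e2) (x e3) (x e4)"
    using dist by (intro frame4.intro) (auto simp: lin dual simp flip: expand)
  then show ?thesis by (rule that)
qed

section \<open>Unimodularity and the orthogonal complement of the exact forms\<close>

lemma ce_d1_two_form:
  fixes \<phi> :: "'a::real_lie_algebra \<Rightarrow> real"
  assumes "linear \<phi>"
  obtains \<beta> where "form2 \<beta> = ce_d1 \<phi>"
proof
  have "bilinear (ce_d1 \<phi>)"
    using assms unfolding bilinear_def
    by (auto simp: ce_d1_def linear_iff bracket_add_left bracket_add_right bracket_scaleR_left
        bracket_scaleR_right)
  moreover have "ce_d1 \<phi> v v = 0" for v
    using assms by (simp add: ce_d1_def bracket_self linear_0)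
  ultimately show "form2 (Abs_two_form (ce_d1 \<phi>)) = ce_d1 \<phi>"
    by (simp add: Abs_two_form_inverse)
qed

lemma wedge22_rotate:
  "form4 (wedge22 \<alpha> \<beta>) b c d a = - form4 (wedge22 \<alpha> \<beta>) a b c d"
  unfolding wedge22.rep_eq form2_skew[of _ b a] form2_skew[of _ c a] form2_skew[of _ d a]
  by algebra

lemma ce_d2_add: "ce_d2 \<alpha> (u + u') v w = ce_d2 \<alpha> u v w + ce_d2 \<alpha> u' v w"
  and ce_d2_scaleR: "ce_d2 \<alpha> (c *\<^sub>R u) v w = c * ce_d2 \<alpha> u v w"
  by (simp_all add: ce_d2_def bracket_add_left bracket_scaleR_left form2_add_left form2_add_right
      form2_scaleR_left form2_scaleR_right algebra_simps)

lemma ce_d2_skew12: "ce_d2 \<alpha> v u w = - ce_d2 \<alpha> u v w"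
  and ce_d2_skew23: "ce_d2 \<alpha> u w v = - ce_d2 \<alpha> u v w"
  by (simp_all add: ce_d2_def bracket_skew[of v u] bracket_skew[of w v] form2_minus_left)

lemma ce_d2_repeated: "ce_d2 \<alpha> u u w = 0" "ce_d2 \<alpha> w u u = 0" "ce_d2 \<alpha> u w u = 0"
  using ce_d2_skew12[of \<alpha> u u w] ce_d2_skew23[of \<alpha> w u u] ce_d2_skew12[of \<alpha> u w u]
    ce_d2_skew23[of \<alpha> w u u] by simp_all

text \<open>For the first dual one-form this is \<open>\<alpha> \<and> dx\<^sub>1 = d\<alpha> \<and> x\<^sub>1\<close> up to sign, evaluated on the frame. The
  two sides differ by traces of \<open>ad e\<^sub>2\<close>, \<open>ad e\<^sub>3\<close> and \<open>ad e\<^sub>4\<close> with coefficients of \<open>\<alpha>\<close> as factors; the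
  other dual one-forms are treated by rotating the frame.\<close>

lemma wedge_coord_differential:
  fixes \<alpha> \<beta> :: "'g::real_lie_algebra two_form"
  assumes frame: "frame4 e1 e2 e3 e4 x1 x2 x3 x4"
    and unimodular: "unimodular TYPE('g)" and \<beta>: "form2 \<beta> = ce_d1 x1"
  shows "form4 (wedge22 \<alpha> \<beta>) e1 e2 e3 e4 = ce_d2 \<alpha> e2 e3 e4"
proof -
  interpret frame4 e1 e2 e3 e4 x1 x2 x3 x4 by (rule frame)
  have lin: "linear (ad u)" for u :: 'g
    by (simp add: ad_def linear_iff bracket_add_right bracket_scaleR_right)
  have trace: "x1 (bracket u e1) + x2 (bracket u e2) + x3 (bracket u e3) + x4 (bracket u e4) = 0" for u
    using unimodular endo_trace_frame[OF lin[of u]] by (simp add: unimodular_def ad_def)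
  have neg: "x1 (- v) = - x1 v" "x2 (- v) = - x2 v" "x3 (- v) = - x3 v" "x4 (- v) = - x4 v" for v
    by (simp_all add: coord_simps)
  \<comment> \<open>The vanishing traces, solved for the structure constants that occur only on the left of the goal.\<close>
  have t2: "x1 (bracket e1 e2) = x3 (bracket e2 e3) + x4 (bracket e2 e4)"
    using trace[of e2] by (simp add: bracket_skew[of e2 e1] neg bracket_self coord_simps)
  have t3: "x1 (bracket e1 e3) = x4 (bracket e3 e4) - x2 (bracket e2 e3)"
    using trace[of e3] by (simp add: bracket_skew[of e3 e1] bracket_skew[of e3 e2] neg bracket_self coord_simps)
  have t4: "x1 (bracket e1 e4) = - x2 (bracket e2 e4) - x3 (bracket e3 e4)"
    using trace[of e4] by (simp add: bracket_skew[of e4 e1] bracket_skew[of e4 e2] bracket_skew[of e4 e3] neg bracket_self coord_simps)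
  show ?thesis
    unfolding wedge22.rep_eq \<beta> ce_d1_def ce_d2_def
      form2_expand[of \<alpha> "bracket e2 e3"] form2_expand[of \<alpha> "bracket e2 e4"]
      form2_expand[of \<alpha> "bracket e3 e4"] dual t2 t3 t4
    by algebra
qed


text \<open>The wedge products of \<open>\<alpha>\<close> with the differentials of the four dual one-forms are, up to sign, the
  four coefficients of the three-form \<open>d\<alpha>\<close>.\<close>

lemma closed2_iff_wedge_exact:
  fixes \<alpha> :: "'g::real_lie_algebra two_form"
  assumes frame: "frame4 e1 e2 e3 e4 x1 x2 x3 x4" and unimodular: "unimodular TYPE('g)"
  shows "closed2 \<alpha> \<longleftrightarrow> (\<forall>\<beta>. exact2 \<beta> \<longrightarrow> form4 (wedge22 \<alpha> \<beta>) e1 e2 e3 e4 = 0)"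
proof -
  interpret frame4 e1 e2 e3 e4 x1 x2 x3 x4 by (rule frame)
  note rot1 = rotate
  note rot2 = frame4.rotate[OF rot1]
  note rot3 = frame4.rotate[OF rot2]
  obtain \<beta>1 \<beta>2 \<beta>3 \<beta>4 where \<beta>: "form2 \<beta>1 = ce_d1 x1" "form2 \<beta>2 = ce_d1 x2"
      "form2 \<beta>3 = ce_d1 x3" "form2 \<beta>4 = ce_d1 x4"
    using linear by (meson ce_d1_two_form)
  let ?W = "\<lambda>\<beta>. form4 (wedge22 \<alpha> \<beta>) e1 e2 e3 e4"
  have W: "?W \<beta>1 = ce_d2 \<alpha> e2 e3 e4" "?W \<beta>2 = - ce_d2 \<alpha> e3 e4 e1"
    "?W \<beta>3 = ce_d2 \<alpha> e4 e1 e2" "?W \<beta>4 = - ce_d2 \<alpha> e1 e2 e3"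
    using wedge_coord_differential[OF frame unimodular \<beta>(1), of \<alpha>]
      wedge_coord_differential[OF rot1 unimodular \<beta>(2), of \<alpha>]
      wedge_coord_differential[OF rot2 unimodular \<beta>(3), of \<alpha>]
      wedge_coord_differential[OF rot3 unimodular \<beta>(4), of \<alpha>]
      wedge22_rotate[of \<alpha> \<beta>2 e2 e3 e4 e1]
      wedge22_rotate[of \<alpha> \<beta>3 e2 e3 e4 e1] wedge22_rotate[of \<alpha> \<beta>3 e3 e4 e1 e2]
      wedge22_rotate[of \<alpha> \<beta>4 e2 e3 e4 e1] wedge22_rotate[of \<alpha> \<beta>4 e3 e4 e1 e2]
      wedge22_rotate[of \<alpha> \<beta>4 e4 e1 e2 e3]
    by linarith+
  show ?thesis
  proof
    assume "closed2 \<alpha>"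
    then have W0: "?W \<beta>1 = 0" "?W \<beta>2 = 0" "?W \<beta>3 = 0" "?W \<beta>4 = 0"
      by (simp_all add: W closed2_def)
    show "\<forall>\<beta>. exact2 \<beta> \<longrightarrow> ?W \<beta> = 0"
    proof (intro allI impI)
      fix \<beta> :: "'g two_form"
      assume "exact2 \<beta>"
      then obtain \<phi> where \<phi>: "linear \<phi>" "form2 \<beta> = ce_d1 \<phi>"
        unfolding exact2_def by blast
      have \<phi>_expand: "\<phi> v = \<phi> e1 * x1 v + \<phi> e2 * x2 v + \<phi> e3 * x3 v + \<phi> e4 * x4 v" for v
      proof -
        have "\<phi> v = \<phi> (x1 v *\<^sub>R e1 + x2 v *\<^sub>R e2 + x3 v *\<^sub>R e3 + x4 v *\<^sub>R e4)"
          by (simp only: expand[symmetric])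
        then show ?thesis
          by (simp add: linear_add[OF \<phi>(1)] linear_scale[OF \<phi>(1)])
      qed
      have form_eq: "form2 \<beta> = form2 (\<phi> e1 *\<^sub>R \<beta>1 + \<phi> e2 *\<^sub>R \<beta>2 + \<phi> e3 *\<^sub>R \<beta>3 + \<phi> e4 *\<^sub>R \<beta>4)"
      proof (intro ext)
        fix u v
        show "form2 \<beta> u v = form2 (\<phi> e1 *\<^sub>R \<beta>1 + \<phi> e2 *\<^sub>R \<beta>2 + \<phi> e3 *\<^sub>R \<beta>3 + \<phi> e4 *\<^sub>R \<beta>4) u v"
          using \<phi>_expand[of "bracket u v"] by (simp add: \<phi>(2) form2_simps \<beta> ce_d1_def)
      qed
      have "?W \<beta> = \<phi> e1 * ?W \<beta>1 + \<phi> e2 * ?W \<beta>2 + \<phi> e3 * ?W \<beta>3 + \<phi> e4 * ?W \<beta>4"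
        unfolding wedge22.rep_eq form_eq unfolding form2_simps by algebra
      then show "?W \<beta> = 0"
        by (simp add: W0)
    qed
  next
    assume *: "\<forall>\<beta>. exact2 \<beta> \<longrightarrow> ?W \<beta> = 0"
    let ?d = "ce_d2 \<alpha>"
    have "exact2 \<beta>1" "exact2 \<beta>2" "exact2 \<beta>3" "exact2 \<beta>4"
      using \<beta> linear unfolding exact2_def by blast+
    with * W have d: "?d e2 e3 e4 = 0" "?d e3 e4 e1 = 0" "?d e4 e1 e2 = 0" "?d e1 e2 e3 = 0"
      by simp_all
    have perm: "?d v u w = 0" "?d u w v = 0" "?d v w u = 0" "?d w u v = 0" "?d w v u = 0"
      if "?d u v w = 0" for u v w
      using that ce_d2_skew12[of \<alpha>] ce_d2_skew23[of \<alpha>] by (metis minus_zero)+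
    have basis: "?d u v w = 0"
      if "u \<in> {e1, e2, e3, e4}" "v \<in> {e1, e2, e3, e4}" "w \<in> {e1, e2, e3, e4}" for u v w
      using that by (auto simp: ce_d2_repeated d perm[OF d(1)] perm[OF d(2)] perm[OF d(3)] perm[OF d(4)])
    have lin: "linear (\<lambda>u. ?d u v w)" for v w
      by (simp add: linear_iff ce_d2_add ce_d2_scaleR)
    have 1: "?d u v w = 0" if "v \<in> {e1, e2, e3, e4}" "w \<in> {e1, e2, e3, e4}" for u v w
      by (rule linear_eq_0I[OF lin]) (use that basis in blast)+
    have 2: "?d v u w = 0" if "w \<in> {e1, e2, e3, e4}" for u v w
      by (rule linear_eq_0I[OF lin], rule_tac[!] perm(1)) (use that 1 in blast)+
    have "?d w u v = 0" for u v w
      by (rule linear_eq_0I[OF lin], rule_tac[!] perm(4)) (use 2 in blast)+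
    then show "closed2 \<alpha>"
      by (simp add: closed2_def)
  qed
qed

section \<open>Self-dual and anti-self-dual coordinates\<close>

context frame4
begin

text \<open>The parameters are coefficients in the basis \<open>x\<^sub>1\<^sub>2 + x\<^sub>3\<^sub>4\<close>, \<open>x\<^sub>1\<^sub>3 - x\<^sub>2\<^sub>4\<close>, \<open>x\<^sub>1\<^sub>4 + x\<^sub>2\<^sub>3\<close> of the
  self-dual and \<open>x\<^sub>1\<^sub>2 - x\<^sub>3\<^sub>4\<close>, \<open>x\<^sub>1\<^sub>3 + x\<^sub>2\<^sub>4\<close>, \<open>x\<^sub>1\<^sub>4 - x\<^sub>2\<^sub>3\<close> of the anti-self-dual forms, where
  \<open>x\<^sub>i\<^sub>j = x\<^sub>i \<and> x\<^sub>j\<close>. In a frame with \<open>J e\<^sub>1 = e\<^sub>2\<close> and \<open>J e\<^sub>3 = e\<^sub>4\<close> the first is the fundamental form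
  of a compatible metric, the next two span the \<open>J\<close>-anti-invariant forms, and the anti-self-dual
  ones are \<open>J\<close>-invariant.\<close>

definition form_of :: "(real \<times> real \<times> real) \<times> (real \<times> real \<times> real) \<Rightarrow> 'a two_form" where
  "form_of = (\<lambda>((s, p, q), (a, b, c)). Abs_two_form (\<lambda>u v.
     (s + a) * (x1 u * x2 v - x2 u * x1 v) + (p + b) * (x1 u * x3 v - x3 u * x1 v)
   + (q + c) * (x1 u * x4 v - x4 u * x1 v) + (q - c) * (x2 u * x3 v - x3 u * x2 v)
   + (b - p) * (x2 u * x4 v - x4 u * x2 v) + (s - a) * (x3 u * x4 v - x4 u * x3 v)))"

lemma form2_form_of:
  "form2 (form_of ((s, p, q), (a, b, c))) u v =
     (s + a) * (x1 u * x2 v - x2 u * x1 v) + (p + b) * (x1 u * x3 v - x3 u * x1 v)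
   + (q + c) * (x1 u * x4 v - x4 u * x1 v) + (q - c) * (x2 u * x3 v - x3 u * x2 v)
   + (b - p) * (x2 u * x4 v - x4 u * x2 v) + (s - a) * (x3 u * x4 v - x4 u * x3 v)"
proof -
  have "bilinear (\<lambda>u v.
     (s + a) * (x1 u * x2 v - x2 u * x1 v) + (p + b) * (x1 u * x3 v - x3 u * x1 v)
   + (q + c) * (x1 u * x4 v - x4 u * x1 v) + (q - c) * (x2 u * x3 v - x3 u * x2 v)
   + (b - p) * (x2 u * x4 v - x4 u * x2 v) + (s - a) * (x3 u * x4 v - x4 u * x3 v))"
    unfolding bilinear_def
    by (intro conjI allI linearI; simp only: coord_simps real_scaleR_def; algebra)
  then show ?thesis
    by (simp add: form_of_def Abs_two_form_inverse)
qed

lemma form2_form_of_frame: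
  "form2 (form_of ((s, p, q), (a, b, c))) e1 e2 = s + a"
  "form2 (form_of ((s, p, q), (a, b, c))) e1 e3 = p + b"
  "form2 (form_of ((s, p, q), (a, b, c))) e1 e4 = q + c"
  "form2 (form_of ((s, p, q), (a, b, c))) e2 e3 = q - c"
  "form2 (form_of ((s, p, q), (a, b, c))) e2 e4 = b - p"
  "form2 (form_of ((s, p, q), (a, b, c))) e3 e4 = s - a"
  by (simp_all add: form2_form_of dual)

lemma linear_form_of: "linear form_of"
proof (rule linearI)
  fix z z' :: "(real \<times> real \<times> real) \<times> (real \<times> real \<times> real)" and r :: real
  obtain s p q a b c where z: "z = ((s, p, q), (a, b, c))" by (metis prod.exhaust)
  obtain s' p' q' a' b' c' where z': "z' = ((s', p', q'), (a', b', c'))" by (metis prod.exhaust)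
  have "form2 (form_of (z + z')) u v = form2 (form_of z + form_of z') u v" for u v
    unfolding z z' form2_simps add_Pair form2_form_of by algebra
  then show "form_of (z + z') = form_of z + form_of z'"
    by (simp add: ext flip: form2_inject)
  have "form2 (form_of (r *\<^sub>R z)) u v = form2 (r *\<^sub>R form_of z) u v" for u v
    unfolding z form2_simps scaleR_Pair form2_form_of real_scaleR_def by algebra
  then show "form_of (r *\<^sub>R z) = r *\<^sub>R form_of z"
    by (simp add: ext flip: form2_inject)
qed

lemma surj_form_of: "surj form_of"
proof (rule surjI)
  fix \<alpha> :: "'a two_form"
  let ?f = "form2 \<alpha>"
  let ?z = "(((?f e1 e2 + ?f e3 e4) / 2, (?f e1 e3 - ?f e2 e4) / 2, (?f e1 e4 + ?f e2 e3) / 2),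
      ((?f e1 e2 - ?f e3 e4) / 2, (?f e1 e3 + ?f e2 e4) / 2, (?f e1 e4 - ?f e2 e3) / 2))"
  have "form2 (form_of ?z) u v = ?f u v" for u v
    unfolding form2_expand[of \<alpha> u v] form2_form_of by (simp add: field_simps)
  then show "form_of ?z = \<alpha>"
    by (simp add: ext flip: form2_inject)
qed

lemma wedge22_form_of:
  "form4 (wedge22 (form_of z) (form_of z')) e1 e2 e3 e4 = 2 * split_form z z'"
proof -
  obtain s p q a b c where z: "z = ((s, p, q), (a, b, c))" by (metis prod.exhaust)
  obtain s' p' q' a' b' c' where z': "z' = ((s', p', q'), (a', b', c'))" by (metis prod.exhaust)
  show ?thesis
    unfolding z z' split_form_def wedge22.rep_eq form2_form_of_frame
    by (simp add: algebra_simps)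
qed

end

definition antiinvariant_plane :: "((real \<times> real \<times> real) \<times> (real \<times> real \<times> real)) set" where
  "antiinvariant_plane = range (\<lambda>(p, q). ((0, p, q), 0))"

lemma antiinvariant_plane_iff: "((s, p, q), (a, b, c)) \<in> antiinvariant_plane \<longleftrightarrow> s = 0 \<and> a = 0 \<and> b = 0 \<and> c = 0"
  by (auto simp: antiinvariant_plane_def zero_prod_def)

lemma subspace_antiinvariant_plane: "subspace antiinvariant_plane"
  and dim_antiinvariant_plane: "dim antiinvariant_plane = 2"
proof -
  have lin: "linear (\<lambda>(p, q). ((0, p, q), 0) :: (real \<times> real \<times> real) \<times> (real \<times> real \<times> real))"
    by (auto simp: linear_iff zero_prod_def)
  show "subspace antiinvariant_plane"
    unfolding antiinvariant_plane_def using lin by (intro linear_subspace_image) auto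
  show "dim antiinvariant_plane = 2"
    unfolding antiinvariant_plane_def
    by (subst dim_linear_image_inj_on[OF lin]) (auto simp: inj_def)
qed

locale complex_frame4 = frame4 +
  fixes J :: "'a \<Rightarrow> 'a"
  assumes almost_complex: "almost_complex J" and J_frame: "J e1 = e2" "J e3 = e4"
begin

lemma J_frame': "J e2 = - e1" "J e4 = - e3"
  using almost_complex by (simp_all add: almost_complex_def flip: J_frame)

lemma linear_J: "linear J"
  using almost_complex by (simp add: almost_complex_def)

lemma coord_J: "x1 (J v) = - x2 v" "x2 (J v) = x1 v" "x3 (J v) = - x4 v" "x4 (J v) = x3 v"
proof -
  have "J v = J (x1 v *\<^sub>R e1 + x2 v *\<^sub>R e2 + x3 v *\<^sub>R e3 + x4 v *\<^sub>R e4)"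
    by (simp only: expand[symmetric])
  also have "\<dots> = x1 v *\<^sub>R e2 - x2 v *\<^sub>R e1 + x3 v *\<^sub>R e4 - x4 v *\<^sub>R e3"
    by (simp add: linear_add[OF linear_J] linear_scale[OF linear_J] J_frame J_frame')
  finally show "x1 (J v) = - x2 v" "x2 (J v) = x1 v" "x3 (J v) = - x4 v" "x4 (J v) = x3 v"
    by (simp_all add: coord_simps linear_diff[OF linear(1)] linear_diff[OF linear(2)]
        linear_diff[OF linear(3)] linear_diff[OF linear(4)])
qed

lemma form_of_Lambda_J_minus_iff: "form_of z \<in> Lambda_J_minus J \<longleftrightarrow> z \<in> antiinvariant_plane"
proof -
  obtain s p q a b c where z: "z = ((s, p, q), (a, b, c))" by (metis prod.exhaust)
  show ?thesis
  proof
    assume "form_of z \<in> Lambda_J_minus J"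
    then have *: "form2 (form_of z) (J u) (J v) = - form2 (form_of z) u v" for u v
      by (simp add: Lambda_J_minus_def)
    from *[of e1 e2] *[of e3 e4] *[of e1 e3] *[of e1 e4]
    show "z \<in> antiinvariant_plane"
      by (simp add: z antiinvariant_plane_iff form2_form_of coord_J dual)
  next
    assume "z \<in> antiinvariant_plane"
    then show "form_of z \<in> Lambda_J_minus J"
      by (auto simp: z antiinvariant_plane_iff Lambda_J_minus_def form2_form_of coord_J algebra_simps)
  qed
qed

text \<open>The quadratic form of the invariant part. The coefficients \<open>p\<close> and \<open>q\<close> of the anti-invariant part drop
  out.\<close>

lemma form_of_taming_value:
  "form2 (form_of ((s, p, q), (a, b, c))) v (J v) =
     s * ((x1 v)\<^sup>2 + (x2 v)\<^sup>2 + (x3 v)\<^sup>2 + (x4 v)\<^sup>2) + a * ((x1 v)\<^sup>2 + (x2 v)\<^sup>2 - (x3 v)\<^sup>2 - (x4 v)\<^sup>2)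
     + 2 * b * (x2 v * x3 v - x1 v * x4 v) + 2 * c * (x1 v * x3 v + x2 v * x4 v)"
  unfolding form2_form_of coord_J by algebra

text \<open>In the complex basis \<open>e\<^sub>1, e\<^sub>3\<close> the Hermitian form has diagonal entries \<open>s + a\<close> and \<open>s - a\<close> and an
  off-diagonal entry of squared modulus \<open>b\<^sup>2 + c\<^sup>2\<close>, so the claim is that its determinant is positive.\<close>

lemma tames_imp_timelike:
  assumes tame: "\<And>v. v \<noteq> 0 \<Longrightarrow> 0 < form2 (form_of ((s, p, q), (a, b, c))) v (J v)"
  shows "a\<^sup>2 + b\<^sup>2 + c\<^sup>2 < s\<^sup>2"
proof -
  have "e1 \<noteq> 0"
    by (metis dual(1) linear(1) linear_0 zero_neq_one)
  from tame[OF this] have pos: "0 < s + a"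
    by (simp add: form_of_taming_value dual)
  \<comment> \<open>The value at this vector is the determinant times \<open>s + a\<close>: it is the minimiser, up to
    scale, when the complex coefficient of \<open>e\<^sub>3\<close> is held fixed.\<close>
  define v where "v = - c *\<^sub>R e1 - b *\<^sub>R e2 + (s + a) *\<^sub>R e3"
  have x: "x1 v = - c" "x2 v = - b" "x3 v = s + a" "x4 v = 0"
    by (simp_all add: v_def coord_simps linear_diff[OF linear(1)] linear_diff[OF linear(2)]
        linear_diff[OF linear(3)] linear_diff[OF linear(4)])
  have "v \<noteq> 0"
    using x(3) pos by (auto simp: coord_simps)
  from tame[OF this] have "0 < (s + a) * (s\<^sup>2 - a\<^sup>2 - b\<^sup>2 - c\<^sup>2)"
    unfolding form_of_taming_value x by (simp add: power2_eq_square algebra_simps)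
  then show ?thesis
    using pos by (simp add: zero_less_mult_iff)
qed

lemma positive_invariant_tames:
  assumes "v \<noteq> 0"
  shows "0 < form2 (form_of ((1, p, q), 0)) v (J v)"
proof -
  have "x1 v \<noteq> 0 \<or> x2 v \<noteq> 0 \<or> x3 v \<noteq> 0 \<or> x4 v \<noteq> 0"
    using assms eqI[of v 0] by (auto simp: coord_simps)
  then have "0 < (x1 v)\<^sup>2 \<or> 0 < (x2 v)\<^sup>2 \<or> 0 < (x3 v)\<^sup>2 \<or> 0 < (x4 v)\<^sup>2"
    by simp
  then have "0 < (x1 v)\<^sup>2 + (x2 v)\<^sup>2 + (x3 v)\<^sup>2 + (x4 v)\<^sup>2"
    using zero_le_power2[of "x1 v"] zero_le_power2[of "x2 v"] zero_le_power2[of "x3 v"]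
      zero_le_power2[of "x4 v"] by linarith
  then show ?thesis
    by (simp add: zero_prod_def form_of_taming_value)
qed

end

section \<open>Cohomology of a unimodular Lie algebra with an almost complex structure\<close>

locale unimodular_complex_frame4 = complex_frame4 e1 e2 e3 e4 x1 x2 x3 x4 J
  for e1 e2 e3 e4 :: "'g::real_lie_algebra" and x1 x2 x3 x4 J +
  fixes \<zeta> :: "'g four_form \<Rightarrow> real" and \<kappa> :: real
  assumes unimodular: "unimodular TYPE('g)"
    and \<kappa>_pos: "0 < \<kappa>" and \<zeta>_eq: "\<zeta> = (\<lambda>\<eta>. \<kappa> * wedge_vec4 e1 e2 e3 e4 \<eta>)"
begin

definition closed_coords :: "((real \<times> real \<times> real) \<times> (real \<times> real \<times> real)) set" where
  "closed_coords = {z. closed2 (form_of z)}"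

definition exact_coords :: "((real \<times> real \<times> real) \<times> (real \<times> real \<times> real)) set" where
  "exact_coords = {z. exact2 (form_of z)}"

lemmas form_of_linear_simps =
  linear_0[OF linear_form_of] linear_add[OF linear_form_of] linear_scale[OF linear_form_of]
  linear_diff[OF linear_form_of]

lemma subspace_exact_coords: "subspace exact_coords"
  by (auto simp: exact_coords_def subspace_def form_of_linear_simps exact2_0 exact2_add exact2_scaleR)

lemma closed_coords_eq: "closed_coords = split_perp exact_coords"
proof -
  have "closed2 (form_of z) \<longleftrightarrow> (\<forall>z'. exact2 (form_of z') \<longrightarrow> split_form z z' = 0)" for z
  proof -
    have "closed2 (form_of z) \<longleftrightarrow>
        (\<forall>z'. exact2 (form_of z') \<longrightarrow> form4 (wedge22 (form_of z) (form_of z')) e1 e2 e3 e4 = 0)"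
      unfolding closed2_iff_wedge_exact[OF frame4_axioms unimodular] using surj_form_of
      by (metis surjD)
    then show ?thesis
      by (simp add: wedge22_form_of)
  qed
  then show ?thesis
    by (auto simp: closed_coords_def exact_coords_def split_perp_def)
qed

lemma subspace_closed_coords: "subspace closed_coords"
  by (simp add: closed_coords_eq subspace_split_perp)

lemma exact_subset_closed: "exact_coords \<subseteq> closed_coords"
  by (auto simp: exact_coords_def closed_coords_def exact2_imp_closed2)

text \<open>The representative chosen by \<^const>\<open>rep_H2\<close> differs from the given one by an exact form, which is
  orthogonal to every closed form and to itself.\<close>

lemma pairing_coh_class:
  assumes z: "z \<in> closed_coords"
  shows "pairing \<zeta> (coh_class (form_of z)) (coh_class (form_of z)) = 2 * \<kappa> * split_form z z"
proof -
  obtain z' where z': "rep_H2 (coh_class (form_of z)) = form_of z'"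
    using surj_form_of by (metis surjD)
  have b: "z' - z \<in> exact_coords"
    using rep_H2_coh_class[of "form_of z"] z
    by (simp add: z' exact_coords_def closed_coords_def form_of_linear_simps)
  have perp: "split_form z (z' - z) = 0" "split_form (z' - z) (z' - z) = 0"
    using b z exact_subset_closed by (auto simp: closed_coords_eq split_perp_def)
  have "split_form (z + (z' - z)) (z + (z' - z)) = split_form z z"
    unfolding split_form_add_left split_form_add_right
    using perp by (simp add: split_form_commute[of "z' - z" z])
  then show ?thesis
    by (simp add: pairing_def z' \<zeta>_eq wedge_vec4_def wedge22_form_of)
qed

lemma linear_cohomology_map:
  obtains \<gamma> where "linear \<gamma>" "\<And>z. z \<in> closed_coords \<Longrightarrow> \<gamma> z = coh_class (form_of z)"
  by (rule linear_extension_from_subspace[OF subspace_closed_coords,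
        of "\<lambda>z. coh_class (form_of z)"])
    (auto simp: closed_coords_def form_of_linear_simps coh_class_add coh_class_scaleR)

text \<open>A class that vanishes is represented by an exact, hence null, form, so a positive definite space of
  closed forms injects into cohomology.\<close>

lemma coh_class_image_positive_subspace:
  assumes U: "subspace U" "U \<subseteq> closed_coords"
    and pos: "\<And>z. z \<in> U \<Longrightarrow> z \<noteq> 0 \<Longrightarrow> 0 < split_form z z"
  shows "subspace ((\<lambda>z. coh_class (form_of z)) ` U)" (is "subspace (?c ` U)")
    and "positive_definite_on \<zeta> ((\<lambda>z. coh_class (form_of z)) ` U)"
    and "dim ((\<lambda>z. coh_class (form_of z)) ` U) = dim U"
proof -
  obtain \<gamma> where \<gamma>: "linear \<gamma>" "\<And>z. z \<in> closed_coords \<Longrightarrow> \<gamma> z = ?c z"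
    using linear_cohomology_map by blast
  have image: "?c ` U = \<gamma> ` U"
    using \<gamma>(2) U(2) by (intro image_cong) auto
  show "subspace (?c ` U)"
    unfolding image using \<gamma>(1) U(1) by (rule linear_subspace_image)
  have "z = 0" if z: "z \<in> U" "\<gamma> z = 0" for z
  proof (rule ccontr)
    assume "z \<noteq> 0"
    have "z \<in> closed_coords"
      using z(1) U(2) by blast
    then have "closed2 (form_of z)" "?c z = 0"
      using \<gamma>(2) z(2) unfolding closed_coords_def by auto
    then have "z \<in> exact_coords"
      by (simp add: exact_coords_def coh_class_eq_0_iff)
    then have "split_form z z = 0"
      using exact_subset_closed by (auto simp: closed_coords_eq split_perp_def)
    with pos[OF z(1) \<open>z \<noteq> 0\<close>] show False by simp
  qed
  then show "dim (?c ` U) = dim U"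
    unfolding image by (intro dim_linear_image_inj_on linear_inj_on_subspace \<gamma>(1) U(1))
  show "positive_definite_on \<zeta> (?c ` U)"
    unfolding positive_definite_on_def
  proof (intro ballI impI)
    fix x assume "x \<in> ?c ` U" "x \<noteq> 0"
    then obtain z where z: "x = ?c z" "z \<in> U" by blast
    have "z \<noteq> 0"
      using \<open>x \<noteq> 0\<close> z(1) coh_class_eq_0_iff[OF closed2_0] by (auto simp: form_of_linear_simps exact2_0)
    then have "0 < split_form z z"
      using pos z(2) by blast
    then show "0 < pairing \<zeta> x x"
      using z U(2) \<kappa>_pos by (auto simp: pairing_coh_class)
  qed
qed

text \<open>A linear section of the class map lifts \<open>W\<close> to closed forms without changing the pairing.\<close>

lemma dim_positive_definite_le:
  assumes W: "subspace W" "positive_definite_on \<zeta> W"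
  shows "dim W + dim exact_coords \<le> 3"
proof -
  let ?c = "\<lambda>z. coh_class (form_of z)"
  obtain \<gamma> where \<gamma>: "linear \<gamma>" "\<And>z. z \<in> closed_coords \<Longrightarrow> \<gamma> z = ?c z"
    using linear_cohomology_map by blast
  obtain g where g: "range g \<subseteq> closed_coords" "linear g" "\<And>x. x \<in> \<gamma> ` closed_coords \<Longrightarrow> \<gamma> (g x) = x"
    using linear_exists_right_inverse_on[OF \<gamma>(1) subspace_closed_coords] by blast
  have surj: "x \<in> \<gamma> ` closed_coords" for x
  proof -
    obtain \<alpha> where \<alpha>: "closed2 \<alpha>" "x = coh_class \<alpha>" by (rule H2_cases)
    obtain z where "\<alpha> = form_of z" using surj_form_of by (metis surjD)
    with \<alpha> have "z \<in> closed_coords" "x = \<gamma> z"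
      using \<gamma>(2)[of z] by (simp_all add: closed_coords_def)
    then show ?thesis by blast
  qed
  have class_g: "?c (g x) = x" for x
    using g(1) g(3)[OF surj] \<gamma>(2) by (metis rangeI subsetD)
  have "inj g"
    by (rule inj_on_inverseI[of _ ?c]) (rule class_g)
  have sub: "subspace (g ` W)"
    using g(2) W(1) by (rule linear_subspace_image)
  have closed: "g ` W \<subseteq> closed_coords"
    using g(1) by blast
  have "dim (g ` W) + dim exact_coords \<le> DIM(real \<times> real \<times> real)"
  proof (rule dim_positive_plus_isotropic_le)
    fix z assume "z \<in> g ` W" "z \<noteq> 0"
    then obtain x where x: "z = g x" "x \<in> W" by blast
    with \<open>z \<noteq> 0\<close> have "x \<noteq> 0"
      using linear_0[OF g(2)] by auto
    then have "0 < pairing \<zeta> x x"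
      using W(2) x(2) by (simp add: positive_definite_on_def)
    then show "0 < split_form z z"
      using pairing_coh_class[OF subsetD[OF g(1) rangeI], of x] \<kappa>_pos
      unfolding class_g x(1) by (simp add: zero_less_mult_iff)
  qed (use sub closed subspace_exact_coords exact_subset_closed in \<open>simp_all add: closed_coords_eq\<close>)
  moreover have "dim (g ` W) = dim W"
    using \<open>inj g\<close> by (intro dim_linear_image_inj_on g(2) W(1)) (auto intro: inj_on_subset)
  ultimately show ?thesis by simp
qed

lemma finite_positive_dims:
  "finite (dim ` {W. subspace W \<and> positive_definite_on \<zeta> W})"
  by (rule finite_subset[of _ "{..3}"]) (auto dest: dim_positive_definite_le)

lemma b_plus_add_dim_exact_le: "b_plus \<zeta> + dim exact_coords \<le> 3"
proof -
  have "{0} \<in> {W. subspace W \<and> positive_definite_on \<zeta> W}"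
    by (simp add: positive_definite_on_def)
  then have "b_plus \<zeta> \<in> dim ` {W. subspace W \<and> positive_definite_on \<zeta> W}"
    unfolding b_plus_def by (intro Max_in finite_positive_dims) blast
  then show ?thesis
    using dim_positive_definite_le by auto
qed

lemma dim_le_b_plus:
  assumes "subspace U" "U \<subseteq> closed_coords"
    and "\<And>z. z \<in> U \<Longrightarrow> z \<noteq> 0 \<Longrightarrow> 0 < split_form z z"
  shows "dim U \<le> b_plus \<zeta>"
proof -
  have "dim U \<in> dim ` {W. subspace W \<and> positive_definite_on \<zeta> W}"
    using coh_class_image_positive_subspace[OF assms] by (metis (mono_tags, lifting) image_eqI mem_Collect_eq)
  then show ?thesis
    unfolding b_plus_def by (rule Max_ge[OF finite_positive_dims])
qed

abbreviation closed_antiinvariant :: "((real \<times> real \<times> real) \<times> (real \<times> real \<times> real)) set" where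
  "closed_antiinvariant \<equiv> antiinvariant_plane \<inter> closed_coords"

lemma subspace_closed_antiinvariant: "subspace closed_antiinvariant"
  by (intro subspace_inter subspace_antiinvariant_plane subspace_closed_coords)

lemma antiinvariant_positive:
  assumes "z \<in> antiinvariant_plane" "z \<noteq> 0"
  shows "0 < split_form z z"
  using assms by (auto simp: antiinvariant_plane_def split_form_def zero_prod_def
      sum_power2_gt_zero_iff simp flip: power2_eq_square)

text \<open>No anti-invariant form is exact apart from \<open>0\<close>, because the anti-invariant plane is positive
  definite.\<close>

lemma h_J_minus_eq: "h_J_minus J = dim closed_antiinvariant"
proof -
  have "{\<alpha> \<in> Lambda_J_minus J. closed2 \<alpha>} = form_of ` closed_antiinvariant"
  proof (intro equalityI subsetI)
    fix \<alpha> assume \<alpha>: "\<alpha> \<in> {\<alpha> \<in> Lambda_J_minus J. closed2 \<alpha>}"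
    obtain z where "\<alpha> = form_of z"
      using surj_form_of by (metis surjD)
    with \<alpha> have "\<alpha> = form_of z" "z \<in> closed_antiinvariant"
      by (simp_all add: closed_coords_def form_of_Lambda_J_minus_iff)
    then show "\<alpha> \<in> form_of ` closed_antiinvariant"
      by (rule image_eqI)
  next
    fix \<alpha> assume "\<alpha> \<in> form_of ` closed_antiinvariant"
    then show "\<alpha> \<in> {\<alpha> \<in> Lambda_J_minus J. closed2 \<alpha>}"
      by (force simp: closed_coords_def form_of_Lambda_J_minus_iff)
  qed
  then have "H_J_minus J = (\<lambda>z. coh_class (form_of z)) ` closed_antiinvariant"
    by (simp add: H_J_minus_def image_image)
  then show ?thesis
    unfolding h_J_minus_def
    using coh_class_image_positive_subspace(3)[OF subspace_closed_antiinvariant] antiinvariant_positive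
    by simp
qed

lemma h_J_minus_le_b_plus: "h_J_minus J \<le> b_plus \<zeta>"
  unfolding h_J_minus_eq
  using subspace_closed_antiinvariant antiinvariant_positive by (intro dim_le_b_plus) auto

lemma h_J_minus_add_dim_sum:
  "h_J_minus J + dim exact_coords + dim {x + y |x y. x \<in> antiinvariant_plane \<and> y \<in> closed_coords} = 8"
  using dim_Int_split_perp[OF subspace_exact_coords subspace_antiinvariant_plane]
  by (simp add: h_J_minus_eq closed_coords_eq dim_antiinvariant_plane)

lemma b_plus_le_h_J_minus_Suc: "b_plus \<zeta> \<le> h_J_minus J + 1"
proof -
  have "dim {x + y |x y. x \<in> antiinvariant_plane \<and> y \<in> closed_coords}
      \<le> DIM((real \<times> real \<times> real) \<times> (real \<times> real \<times> real))"
    by (rule dim_subset_UNIV)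
  then show ?thesis
    using h_J_minus_add_dim_sum b_plus_add_dim_exact_le by simp
qed

text \<open>If the fundamental form \<open>((1, 0, 0), 0)\<close> were a sum of an anti-invariant and a closed form, the closed
  summand would have the same invariant part and would tame \<open>J\<close>.\<close>

lemma b_plus_le_h_J_minus_if_not_tamed: 
  assumes "\<not> tamed J"
  shows "b_plus \<zeta> \<le> h_J_minus J"
proof -
  let ?S = "{x + y |x y. x \<in> antiinvariant_plane \<and> y \<in> closed_coords}"
  have "((1, 0, 0), 0) \<notin> ?S"
  proof
    assume "((1, 0, 0), 0) \<in> ?S"
    then obtain x y where xy: "((1, 0, 0), 0) = x + y" "x \<in> antiinvariant_plane"
        and y: "y \<in> closed_coords"
      by blast
    from xy(2) obtain p q where "x = ((0, p, q), 0)"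
      by (auto simp: antiinvariant_plane_def)
    then have "y = ((1, 0, 0), 0) - ((0, p, q), 0)"
      using xy(1) by (simp only: add_diff_cancel_left')
    then have "y = ((1, - p, - q), 0)"
      by simp
    with y have "closed2 (form_of ((1, - p, - q), 0))"
      by (simp add: closed_coords_def)
    moreover have "\<forall>v. v \<noteq> 0 \<longrightarrow> 0 < form2 (form_of ((1, - p, - q), 0)) v (J v)"
      using positive_invariant_tames by blast
    ultimately have "tamed J"
      unfolding tamed_def by blast
    with assms show False ..
  qed
  moreover have "span ?S = ?S"
    unfolding span_eq_iff
    by (rule subspace_sums[OF subspace_antiinvariant_plane subspace_closed_coords])
  ultimately have "span ?S \<noteq> UNIV"
    by (metis UNIV_I)
  then have "dim ?S \<noteq> DIM((real \<times> real \<times> real) \<times> (real \<times> real \<times> real))"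
    unfolding dim_eq_full .
  moreover have "dim ?S \<le> DIM((real \<times> real \<times> real) \<times> (real \<times> real \<times> real))"
    by (rule dim_subset_UNIV)
  ultimately have "dim ?S \<le> 5"
    by simp
  then show ?thesis
    using h_J_minus_add_dim_sum b_plus_add_dim_exact_le by simp
qed

text \<open>The anti-invariant part of a taming form need not be orthogonal to the closed anti-invariant forms.
  It does no harm: it changes only the component in the positive definite plane.\<close>

lemma h_J_minus_less_b_plus_if_tamed:
  assumes "tamed J"
  shows "h_J_minus J + 1 \<le> b_plus \<zeta>"
proof -
  obtain \<phi> where \<phi>: "closed2 \<phi>" "\<And>v. v \<noteq> 0 \<Longrightarrow> 0 < form2 \<phi> v (J v)"
    using assms unfolding tamed_def by blast
  obtain f where f: "\<phi> = form_of f"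
    using surj_form_of by (metis surjD)
  obtain s p q a b c where fz: "f = ((s, p, q), (a, b, c))" by (metis prod.exhaust)
  have timelike: "a\<^sup>2 + b\<^sup>2 + c\<^sup>2 < s\<^sup>2"
    using \<phi>(2) by (intro tames_imp_timelike[of s p q a b c]) (simp add: f fz)
  moreover have "0 \<le> a\<^sup>2 + b\<^sup>2 + c\<^sup>2"
    by simp
  ultimately have "s\<^sup>2 \<noteq> 0"
    by linarith
  then have "s \<noteq> 0"
    by simp
  let ?U = "span (insert f closed_antiinvariant)"
  have "f \<notin> closed_antiinvariant"
    using \<open>s \<noteq> 0\<close> by (simp add: fz antiinvariant_plane_iff)
  then have "dim ?U = h_J_minus J + 1"
    using dim_insert[of f closed_antiinvariant] subspace_closed_antiinvariant
    by (simp add: h_J_minus_eq span_eq_iff[THEN iffD2])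
  moreover have "dim ?U \<le> b_plus \<zeta>"
  proof (rule dim_le_b_plus)
    have "f \<in> closed_coords"
      using \<phi>(1) by (simp add: f closed_coords_def)
    then show "?U \<subseteq> closed_coords"
      by (intro span_minimal subspace_closed_coords) auto
  next
    fix z assume "z \<in> ?U" "z \<noteq> 0"
    then obtain k where "z - k *\<^sub>R f \<in> closed_antiinvariant"
      using subspace_closed_antiinvariant by (auto simp: span_insert span_eq_iff[THEN iffD2])
    then obtain l m where "z - k *\<^sub>R f = ((0, l, m), 0)"
      by (auto simp: antiinvariant_plane_def)
    then have "z = k *\<^sub>R f + ((0, l, m), 0)"
      by (simp add: algebra_simps)
    then have z: "z = ((k * s, k * p + l, k * q + m), (k * a, k * b, k * c))"
      by (simp add: fz zero_prod_def)
    have eq: "split_form z z = k\<^sup>2 * (s\<^sup>2 - (a\<^sup>2 + b\<^sup>2 + c\<^sup>2)) + ((k * p + l)\<^sup>2 + (k * q + m)\<^sup>2)"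
      by (simp add: z split_form_def power2_eq_square algebra_simps)
    show "0 < split_form z z"
    proof (cases "k = 0")
      case True
      then show ?thesis
        using \<open>z \<noteq> 0\<close> z by (intro antiinvariant_positive) (simp_all add: antiinvariant_plane_iff)
    next
      case False
      then show ?thesis
        unfolding eq using timelike by (intro add_pos_nonneg mult_pos_pos) auto
    qed
  qed simp
  ultimately show ?thesis by simp
qed

end

theorem theorem0p4:
  fixes J :: "'g::real_lie_algebra \<Rightarrow> 'g"
    and \<zeta> :: "'g four_form \<Rightarrow> real"
  assumes "dim (UNIV :: 'g set) = 4"
    and "unimodular TYPE('g)"
    and "almost_complex J"
    and "induces_orientation J \<zeta>"
  shows "(h_J_minus J = b_plus \<zeta> \<or> int (h_J_minus J) = int (b_plus \<zeta>) - 1) \<and>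
         (tamed J \<longleftrightarrow> int (h_J_minus J) = int (b_plus \<zeta>) - 1)"
proof -
  obtain v w c where vw: "independent {v, J v, w, J w}" "card {v, J v, w, J w} = 4"
    and c: "0 < c" and \<zeta>: "\<zeta> = (\<lambda>\<eta>. c * wedge_vec4 v (J v) w (J w) \<eta>)"
    using assms(4) unfolding induces_orientation_def by blast
  obtain x1 x2 x3 x4 where "frame4 v (J v) w (J w) x1 x2 x3 x4"
    using frame4_of_basis[OF vw assms(1)] .
  then interpret unimodular_complex_frame4 v "J v" w "J w" x1 x2 x3 x4 J \<zeta> c
    using assms(2,3) c \<zeta>
    by (intro unimodular_complex_frame4.intro complex_frame4.intro complex_frame4_axioms.intro
        unimodular_complex_frame4_axioms.intro) auto
  show ?thesis
  proof (cases "tamed J")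
    case True
    with h_J_minus_less_b_plus_if_tamed b_plus_le_h_J_minus_Suc have "b_plus \<zeta> = h_J_minus J + 1"
      by (intro antisym)
    with True show ?thesis by simp
  next
    case False
    with b_plus_le_h_J_minus_if_not_tamed h_J_minus_le_b_plus have "b_plus \<zeta> = h_J_minus J"
      by (intro antisym)
    with False show ?thesis by simp
  qed
qed

end
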